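(* Let $G=\mathbb{Z}_+^k$ with $k\ge 1$, or let $G$ be a countable infinite discrete amenable group. Let $\Omega$ be a locally compact, separable metric space with Borel $\sigma$-algebra $\mathcal{B}(\Omega)$, and let $(\Omega,\mathcal{B}(\Omega),\mathbb{P},G)$ be an ergodic measure-preserving system. Let $T=(T_{g,\omega})_{g\in G,\omega\in\Omega}$ be a random dynamical system on a compact metric space $X$ over $(\Omega,\mathcal{B}(\Omega),\mathbb{P},G)$. If $\Gamma:L^1_{\mathbb{P}}(\Omega,C(X))\to\mathbb{R}$ is a random pressure function, then $$\Gamma(0)=\max_{\mu\in\mathcal{M}_{\mathbb{P}}(\Omega\times X,G)}s(\mu),$$ where $$s(\mu)=\inf\Big\{\Gamma(f)-\int f\,d\mu: f\in L^1_{\mathbb{P}}(\Omega,C(X))\Big\}=\inf_{f\in\mathcal{A}}\int f\,d\mu,$$ and $\mathcal{A}=\{f\in L^1_{\mathbb{P}}(\Omega,C(X)):\Gamma(-f)=0\}$. Furthermore, $s(\mu)$ is a concave and upper semi-continuous function of $\mu$ on $\mathcal{M}_{\mathbb{P}}(\Omega\times X,G)$.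
   Context: $\mathbb{Z}_+^k=\{(x_1,\dots,x_k)\in\mathbb{Z}^k: x_j\ge 0\}$ is regarded as an additive semigroup with identity $e_G=(0,\dots,0)$. A countable group $G$ is amenable if it has a Følner sequence, i.e. a sequence $\{F_n\}$ of non-empty finite subsets with $\lim_n |gF_n\triangle F_n|/|F_n|=0$ for all $g\in G$. A measure-preserving system $(\Omega,\mathcal{F},\mathbb{P},G)$ is a probability space with a measurable action of $G$, written $\omega\mapsto g\omega$ (with $e_G\omega=\omega$, $(g_1g_2)\omega=g_1(g_2\omega)$), such that $\mathbb{P}(g^{-1}A)=\mathbb{P}(A)$ for all $A\in\mathcal{F}$, $g\in G$. A random dynamical system (RDS) on a compact metric space $X$ over $(\Omega,\mathcal{F},\mathbb{P},G)$ is a family of continuous maps $T_{g,\omega}:X\to X$ ($g\in G$, $\omega\in\Omega$) such that: $(\omega,x)\mapsto T_{g,\omega}x$ is measurable with respect to $\mathcal{F}\otimes\mathcal{B}(X)$; $T_{e_G,\omega}=\mathrm{id}_X$ for all $\omega$; and $T_{g_1g_2,\omega}=T_{g_1,g_2\omega}\circ T_{g_2,\omega}$ for all $g_1,g_2\in G$ and $\omega$. The skew product transformations are $\Theta_g:\Omega\times X\to\Omega\times X$, $\Theta_g(\omega,x)=(g\omega,T_{g,\omega}x)$; they define an action of $G$ on $\Omega\times X$. $L^1_{\mathbb{P}}(\Omega,C(X))$ is the Banach space of functions $f:\Omega\times X\to\mathbb{R}$, measurable in $(\omega,x)$ and continuous in $x$, with $\|f\|:=\int\|f(\omega)\|_\infty\,d\mathbb{P}(\omega)<\infty$,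 where $\|f(\omega)\|_\infty=\sup_{x\in X}|f(\omega,x)|$; functions $f,g$ with $\|f-g\|=0$ are identified. $\mathcal{P}_{\mathbb{P}}(\Omega\times X)$ is the set of probability measures $\mu$ on $(\Omega\times X,\mathcal{F}\otimes\mathcal{B}(X))$ whose push-forward under the projection $\pi_\Omega:\Omega\times X\to\Omega$ is $\mathbb{P}$, endowed with the weak$^*$ topology, i.e. the smallest topology making $\mu\mapsto\int f\,d\mu$ continuous for all $f\in L^1_{\mathbb{P}}(\Omega,C(X))$. $\mathcal{M}_{\mathbb{P}}(\Omega\times X,G)$ is the subset of those $\mu\in\mathcal{P}_{\mathbb{P}}(\Omega\times X)$ that are $\Theta_g$-invariant for all $g\in G$. A function $\Gamma:L^1_{\mathbb{P}}(\Omega,C(X))\to\mathbb{R}$ is a random pressure function if for all $f,g\in L^1_{\mathbb{P}}(\Omega,C(X))$: (1) (monotonicity) $f\le g\Rightarrow\Gamma(f)\le\Gamma(g)$; (2) (translation invariance) $\Gamma(f+c)=\Gamma(f)+c$ for all $c\in\mathbb{R}$; (3) (convexity) $\Gamma(pf+(1-p)g)\le p\Gamma(f)+(1-p)\Gamma(g)$ for all $p\in[0,1]$; (4) (Lipschitz) $|\Gamma(f)-\Gamma(g)|\le\|f-g\|$; (5) (semi-cohomology) $\Gamma(f\circ\Theta_h)\le\Gamma(f)$ for all $h\in G$. *)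

theory Defs
  imports "HOL-Probability.Probability" "HOL-Algebra.Coset"
begin

text \<open>The semigroups are monoids in the sense of HOL-Algebra, written multiplicatively.\<close>

definition Zplus :: "nat \<Rightarrow> (nat \<Rightarrow> int) monoid" where
  "Zplus k = \<lparr>carrier = {..<k} \<rightarrow>\<^sub>E {0..},
              mult = (\<lambda>x y. \<lambda>j\<in>{..<k}. x j + y j),
              one = (\<lambda>j\<in>{..<k}. 0)\<rparr>"

definition folner_sequence :: "('g, 'b) monoid_scheme \<Rightarrow> (nat \<Rightarrow> 'g set) \<Rightarrow> bool" where
  "folner_sequence G F \<longleftrightarrow>
     (\<forall>n. F n \<subseteq> carrier G \<and> finite (F n) \<and> F n \<noteq> {}) \<and>
     (\<forall>g\<in>carrier G.
        (\<lambda>n. real (card (sym_diff (g <#\<^bsub>G\<^esub> F n) (F n))) / real (card (F n))) \<longlonglongrightarrow> 0)"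

definition countable_amenable_group :: "('g, 'b) monoid_scheme \<Rightarrow> bool" where
  "countable_amenable_group G \<longleftrightarrow>
     group G \<and> countable (carrier G) \<and> (\<exists>F. folner_sequence G F)"

definition measure_preserving_map :: "'a measure \<Rightarrow> ('a \<Rightarrow> 'a) \<Rightarrow> bool" where
  "measure_preserving_map M f \<longleftrightarrow>
     f \<in> measurable M M \<and> (\<forall>A\<in>sets M. emeasure M (f -` A \<inter> space M) = emeasure M A)"

text \<open>Since \<open>G\<close> is countable and discrete, measurability of the action means measurability of
  each map \<open>act g\<close>; this is part of \<open>measure_preserving_map\<close>.\<close>

locale measure_preserving_system = prob_space P + monoid G
  for P :: "'w measure" and G :: "('g, 'b) monoid_scheme" (structure) +
  fixes act :: "'g \<Rightarrow> 'w \<Rightarrow> 'w"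
  assumes act_one: "\<omega> \<in> space P \<Longrightarrow> act \<one> \<omega> = \<omega>"
    and act_mult: "g \<in> carrier G \<Longrightarrow> h \<in> carrier G \<Longrightarrow> \<omega> \<in> space P
                     \<Longrightarrow> act (g \<otimes> h) \<omega> = act g (act h \<omega>)"
    and act_preserving: "g \<in> carrier G \<Longrightarrow> measure_preserving_map P (act g)"

locale ergodic_system = measure_preserving_system P G act
  for P :: "'w measure" and G :: "('g, 'b) monoid_scheme" (structure)
    and act :: "'g \<Rightarrow> 'w \<Rightarrow> 'w" +
  assumes ergodic: "A \<in> sets P \<Longrightarrow> (\<forall>g\<in>carrier G. act g -` A \<inter> space P = A)
                      \<Longrightarrow> emeasure P A = 0 \<or> emeasure P A = 1"

text \<open>The metric space \<open>X\<close> is the type \<open>'x\<close>.\<close>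

locale random_dynamical_system = measure_preserving_system P G act
  for P :: "'w measure" and G :: "('g, 'b) monoid_scheme" (structure)
    and act :: "'g \<Rightarrow> 'w \<Rightarrow> 'w" +
  fixes T :: "'g \<Rightarrow> 'w \<Rightarrow> 'x :: metric_space \<Rightarrow> 'x"
  assumes compact_fibre: "compact (UNIV :: 'x set)"
    and T_continuous: "g \<in> carrier G \<Longrightarrow> \<omega> \<in> space P \<Longrightarrow> continuous_on UNIV (T g \<omega>)"
    and T_measurable: "g \<in> carrier G
                         \<Longrightarrow> (\<lambda>(\<omega>, x). T g \<omega> x) \<in> measurable (P \<Otimes>\<^sub>M borel) borel"
    and T_one: "\<omega> \<in> space P \<Longrightarrow> T \<one> \<omega> = id"
    and T_cocycle: "g \<in> carrier G \<Longrightarrow> h \<in> carrier G \<Longrightarrow> \<omega> \<in> space P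
                      \<Longrightarrow> T (g \<otimes> h) \<omega> = T g (act h \<omega>) \<circ> T h \<omega>"

definition skew_product ::
  "('g \<Rightarrow> 'w \<Rightarrow> 'w) \<Rightarrow> ('g \<Rightarrow> 'w \<Rightarrow> 'x \<Rightarrow> 'x) \<Rightarrow> 'g \<Rightarrow> 'w \<times> 'x \<Rightarrow> 'w \<times> 'x" where
  "skew_product act T g = (\<lambda>(\<omega>, x). (act g \<omega>, T g \<omega> x))"

text \<open>Elements of \<open>L\<^sup>1\<^sub>P(\<Omega>, C(X))\<close> are represented by functions, without passing to the quotient by
  \<open>L1C_norm P (f - g) = 0\<close>. The order on classes is therefore the one that holds for almost every
  \<open>\<omega>\<close>, and the Lipschitz condition below forces a random pressure function to take the same value
  on identified functions.\<close>

definition L1C_norm :: "'w measure \<Rightarrow> ('w \<times> 'x \<Rightarrow> real) \<Rightarrow> real" where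
  "L1C_norm P f = (\<integral>\<omega>. (SUP x. \<bar>f (\<omega>, x)\<bar>) \<partial>P)"

definition L1C :: "'w measure \<Rightarrow> ('w \<times> 'x :: metric_space \<Rightarrow> real) set" where
  "L1C P = {f \<in> borel_measurable (P \<Otimes>\<^sub>M borel).
              (\<forall>\<omega>\<in>space P. continuous_on UNIV (\<lambda>x. f (\<omega>, x))) \<and>
              integrable P (\<lambda>\<omega>. SUP x. \<bar>f (\<omega>, x)\<bar>)}"

definition prob_with_marginal :: "'w measure \<Rightarrow> ('w \<times> 'x :: metric_space) measure set" where
  "prob_with_marginal P =
     {\<mu>. prob_space \<mu> \<and> sets \<mu> = sets (P \<Otimes>\<^sub>M borel) \<and> distr \<mu> P fst = P}"

definition weak_star_topology ::
  "'w measure \<Rightarrow> ('w \<times> 'x :: metric_space) measure topology" where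
  "weak_star_topology P = topology_generated_by
     {{\<mu> \<in> prob_with_marginal P. (\<integral>z. f z \<partial>\<mu>) \<in> U} | f U. f \<in> L1C P \<and> open U}"

definition invariant_measures ::
  "'w measure \<Rightarrow> ('g, 'b) monoid_scheme \<Rightarrow> ('g \<Rightarrow> 'w \<Rightarrow> 'w)
    \<Rightarrow> ('g \<Rightarrow> 'w \<Rightarrow> 'x :: metric_space \<Rightarrow> 'x) \<Rightarrow> ('w \<times> 'x) measure set" where
  "invariant_measures P G act T =
     {\<mu> \<in> prob_with_marginal P. \<forall>g\<in>carrier G. measure_preserving_map \<mu> (skew_product act T g)}"

definition random_pressure_function ::
  "'w measure \<Rightarrow> ('g, 'b) monoid_scheme \<Rightarrow> ('g \<Rightarrow> 'w \<Rightarrow> 'w)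
    \<Rightarrow> ('g \<Rightarrow> 'w \<Rightarrow> 'x :: metric_space \<Rightarrow> 'x) \<Rightarrow> (('w \<times> 'x \<Rightarrow> real) \<Rightarrow> real) \<Rightarrow> bool" where
  "random_pressure_function P G act T \<Gamma> \<longleftrightarrow>
     (\<forall>f\<in>L1C P. \<forall>g\<in>L1C P. (AE \<omega> in P. \<forall>x. f (\<omega>, x) \<le> g (\<omega>, x)) \<longrightarrow> \<Gamma> f \<le> \<Gamma> g) \<and>
     (\<forall>f\<in>L1C P. \<forall>c. \<Gamma> (\<lambda>z. f z + c) = \<Gamma> f + c) \<and>
     (\<forall>f\<in>L1C P. \<forall>g\<in>L1C P. \<forall>p\<in>{0..1}.
        \<Gamma> (\<lambda>z. p * f z + (1 - p) * g z) \<le> p * \<Gamma> f + (1 - p) * \<Gamma> g) \<and>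
     (\<forall>f\<in>L1C P. \<forall>g\<in>L1C P. \<bar>\<Gamma> f - \<Gamma> g\<bar> \<le> L1C_norm P (\<lambda>z. f z - g z)) \<and>
     (\<forall>f\<in>L1C P. \<forall>h\<in>carrier G. \<Gamma> (f \<circ> skew_product act T h) \<le> \<Gamma> f)"

text \<open>The infimum may be \<open>-\<infinity>\<close>, hence the extended reals; it is never \<open>\<infinity>\<close>.\<close>

definition pressure_dual ::
  "'w measure \<Rightarrow> (('w \<times> 'x :: metric_space \<Rightarrow> real) \<Rightarrow> real) \<Rightarrow> ('w \<times> 'x) measure \<Rightarrow> ereal" where
  "pressure_dual P \<Gamma> \<mu> = (INF f\<in>L1C P. ereal (\<Gamma> f - (\<integral>z. f z \<partial>\<mu>)))"

definition mixture :: "real \<Rightarrow> 'a measure \<Rightarrow> 'a measure \<Rightarrow> 'a measure" where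
  "mixture p \<mu> \<nu> = measure_of (space \<mu>) (sets \<mu>)
     (\<lambda>A. ennreal p * emeasure \<mu> A + ennreal (1 - p) * emeasure \<nu> A)"

text \<open>Concavity includes convexity of the domain. At \<open>p = 0\<close> and \<open>p = 1\<close> the convention
  \<open>0 * (-\<infinity>) = 0\<close> of \<^typ>\<open>ereal\<close> gives the right reading.\<close>

definition concave_on_measures :: "'a measure set \<Rightarrow> ('a measure \<Rightarrow> ereal) \<Rightarrow> bool" where
  "concave_on_measures K s \<longleftrightarrow>
     (\<forall>\<mu>\<in>K. \<forall>\<nu>\<in>K. \<forall>p\<in>{0..1}. mixture p \<mu> \<nu> \<in> K \<and>
        ereal p * s \<mu> + ereal (1 - p) * s \<nu> \<le> s (mixture p \<mu> \<nu>))"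

definition upper_semicontinuous :: "'a topology \<Rightarrow> ('a \<Rightarrow> ereal) \<Rightarrow> bool" where
  "upper_semicontinuous X s \<longleftrightarrow> (\<forall>a. openin X {x \<in> topspace X. s x < a})"

end

theory Submission
  imports Defs
begin

text \<open>Put \<open>\<Gamma>\<^sub>0 = \<Gamma> - \<Gamma> 0\<close> and let \<open>q f\<close> be the upper limit of \<open>\<Gamma>\<^sub>0\<close> at the averages of \<open>f\<close> along a
  Folner sequence. Semi-cohomology and convexity give \<open>q \<le> \<Gamma>\<^sub>0\<close>, and the Lipschitz condition gives
  \<open>q (f \<circ> \<Theta>\<^sub>h - f) \<le> 0\<close>, so every linear functional \<open>L \<le> q\<close> is invariant; one exists by the
  Hahn-Banach theorem. Monotonicity and translation invariance make \<open>L\<close> positive and normalised.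
  If \<open>f\<^sub>n\<close> decreases to \<open>0\<close>, then its norms tend to \<open>0\<close> by Dini's theorem on the compact fibres, so \<open>L\<close>
  is represented by a probability measure by Daniell's theorem. Its marginal is \<open>P\<close> because \<open>L\<close> is
  bounded by the norm on indicators of sets of \<open>\<Omega>\<close> and of their complements.\<close>

subsection \<open>Minimal convex functionals and the Hahn-Banach theorem\<close>

text \<open>A linear functional below \<open>\<Gamma>\<^sub>0\<close> alone need not be invariant.
  The averaging is therefore put into the majorant before the extension, so that no compactness or
  fixed-point argument is needed afterwards. The averaged values need not converge, but an upper
  limit keeps convexity. Since \<Gamma> is convex without being assumed positively homogeneous, the
  Hahn-Banach theorem is used for convex majorants. The functions are only measurable in \<omega>,
  so \<open>L\<close> lives on a vector lattice of functions rather than on the continuous functions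
  of a compact space; hence Daniell's theorem in place of Riesz's. The maps \<Theta> need not be
  invertible on the semigroup side: the inequality for coboundaries, applied to f and to - f,
  already gives invariance. The resulting bound \<integral> f d\<mu> \<le> \<Gamma> f - \<Gamma> 0
  says that \<mu> is a subgradient of \<Gamma> at 0, which is \<Gamma> 0 \<le> s(\<mu>). Taking f =
  0 in the infimum gives s(\<mu>) \<le> \<Gamma> 0 for every \<mu>, so the maximum is
  attained.\<close>

lemma Inf_le_convex_combination:
  fixes A B C :: "real set"
  assumes "A \<noteq> {}" "B \<noteq> {}" "bdd_below C" "p \<in> {0..1}"
    and step: "\<And>x y. x \<in> A \<Longrightarrow> y \<in> B \<Longrightarrow> \<exists>z\<in>C. z \<le> p * x + (1 - p) * y"
  shows "Inf C \<le> p * Inf A + (1 - p) * Inf B"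
proof (rule field_le_epsilon)
  fix e :: real assume "0 < e"
  obtain x where x: "x \<in> A" "x < Inf A + e"
    using cInf_lessD[OF \<open>A \<noteq> {}\<close>, of "Inf A + e"] \<open>0 < e\<close> by auto
  obtain y where y: "y \<in> B" "y < Inf B + e"
    using cInf_lessD[OF \<open>B \<noteq> {}\<close>, of "Inf B + e"] \<open>0 < e\<close> by auto
  obtain z where z: "z \<in> C" "z \<le> p * x + (1 - p) * y" using step x y by blast
  have "Inf C \<le> z" by (rule cInf_lower) fact+
  also note z(2)
  also have "p * x + (1 - p) * y \<le> p * (Inf A + e) + (1 - p) * (Inf B + e)"
    using x y \<open>p \<in> {0..1}\<close> by (intro add_mono mult_left_mono) auto
  \<comment> \<open>The weights add up to 1, so the two errors \<open>e\<close> count as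
    one.\<close>
  also have "\<dots> = p * Inf A + (1 - p) * Inf B + e" by (simp add: algebra_simps)
  finally show "Inf C \<le> p * Inf A + (1 - p) * Inf B + e" .
qed

locale function_space =
  fixes V :: "('a \<Rightarrow> real) set"
  assumes zero_mem: "(\<lambda>_. 0) \<in> V"
    and lincomb_mem: "f \<in> V \<Longrightarrow> g \<in> V \<Longrightarrow> (\<lambda>z. a * f z + b * g z) \<in> V"
begin

lemma scale_mem: "f \<in> V \<Longrightarrow> (\<lambda>z. a * f z) \<in> V"
  using lincomb_mem[of f f a 0] by simp

lemma add_mem: "f \<in> V \<Longrightarrow> g \<in> V \<Longrightarrow> (\<lambda>z. f z + g z) \<in> V"
  using lincomb_mem[of f g 1 1] by simp

lemma diff_mem: "f \<in> V \<Longrightarrow> g \<in> V \<Longrightarrow> (\<lambda>z. f z - g z) \<in> V"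
  using lincomb_mem[of f g 1 "-1"] by simp

lemma uminus_mem: "f \<in> V \<Longrightarrow> (\<lambda>z. - f z) \<in> V"
  using scale_mem[of f "-1"] by simp

lemma sum_mem: "(\<And>i. i \<in> I \<Longrightarrow> f i \<in> V) \<Longrightarrow> (\<lambda>z. \<Sum>i\<in>I. f i z) \<in> V"
  by (induction I rule: infinite_finite_induct) (auto simp: zero_mem intro: add_mem)

definition linear_functional :: "(('a \<Rightarrow> real) \<Rightarrow> real) \<Rightarrow> bool" where
  "linear_functional L \<longleftrightarrow>
     (\<forall>f\<in>V. \<forall>g\<in>V. \<forall>a b. L (\<lambda>z. a * f z + b * g z) = a * L f + b * L g)"

definition convex_functional :: "(('a \<Rightarrow> real) \<Rightarrow> real) \<Rightarrow> bool" where
  "convex_functional q \<longleftrightarrow>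
     (\<forall>f\<in>V. \<forall>g\<in>V. \<forall>p\<in>{0..1}. q (\<lambda>z. p * f z + (1 - p) * g z) \<le> p * q f + (1 - p) * q g)"

lemma convex_functionalD:
  "convex_functional q \<Longrightarrow> f \<in> V \<Longrightarrow> g \<in> V \<Longrightarrow> 0 \<le> p \<Longrightarrow> p \<le> 1
    \<Longrightarrow> q (\<lambda>z. p * f z + (1 - p) * g z) \<le> p * q f + (1 - p) * q g"
  by (auto simp: convex_functional_def)

text \<open>The midpoint of f and - f is 0, so convexity gives 0 \<le> (q f + q (- f)) / 2.\<close>

lemma convex_functional_uminus:
  assumes "convex_functional q" "q (\<lambda>_. 0) = 0" "f \<in> V"
  shows "- q (\<lambda>z. - f z) \<le> q f"
  using convex_functionalD[OF assms(1,3) uminus_mem[OF assms(3)], of "1/2"] assms(2) by simp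

text \<open>The value 0 outside \<open>V\<close> is prescribed because functionals are compared on
  all functions: were those values free, they could be lowered without end, and no minimal element
  would exist when \<open>V\<close> is not everything.\<close>

definition convex_minorants :: "(('a \<Rightarrow> real) \<Rightarrow> real) \<Rightarrow> (('a \<Rightarrow> real) \<Rightarrow> real) set" where
  "convex_minorants q = {m. convex_functional m \<and> m (\<lambda>_. 0) = 0 \<and> (\<forall>f\<in>V. m f \<le> q f) \<and> (\<forall>f. f \<notin> V \<longrightarrow> m f = 0)}"

text \<open>Since m (- f) \<le> q (- f), this bound does not depend on \<open>m\<close>; it keeps
  infima over chains finite.\<close>

lemma convex_minorants_lower:
  assumes "convex_functional q" "m \<in> convex_minorants q" "f \<in> V"
  shows "- q (\<lambda>z. - f z) \<le> m f"
  using convex_functional_uminus[of m f] assms uminus_mem[of f] unfolding convex_minorants_def by force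

text \<open>Zorn's lemma for the reversed pointwise order: a nonempty chain is bounded by its
  pointwise infimum.\<close>

lemma convex_minorants_minimal:
  assumes q: "convex_functional q" "q (\<lambda>_. 0) = 0"
  shows "\<exists>m\<in>convex_minorants q. \<forall>m'\<in>convex_minorants q. m' \<le> m \<longrightarrow> m' = m"
proof (rule predicate_Zorn[where P = "\<lambda>m m'. m' \<le> m"])
  show "partial_order_on (convex_minorants q) (relation_of (\<lambda>m m'. m' \<le> m) (convex_minorants q))"
    by (rule partial_order_on_relation_ofI) auto
next
  fix C assume C: "C \<in> Chains (relation_of (\<lambda>m m'. m' \<le> m) (convex_minorants q))"
  show "\<exists>u\<in>convex_minorants q. \<forall>m\<in>C. u \<le> m"
  proof (cases "C = {}")
    case True
    \<comment> \<open>The empty chain only asks for some member, and \<open>q\<close> cut off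
      outside \<open>V\<close> is one.\<close>
    have "(\<lambda>f. if f \<in> V then q f else 0) \<in> convex_minorants q"
      using q by (auto simp: convex_minorants_def convex_functional_def zero_mem lincomb_mem)
    then show ?thesis using True by blast
  next
    case False
    have CM: "m \<in> convex_minorants q" if "m \<in> C" for m
      using C that by (auto simp: Chains_def relation_of_def)
    have total: "m \<le> m' \<or> m' \<le> m" if "m \<in> C" "m' \<in> C" for m m'
      using C that by (auto simp: Chains_def relation_of_def)
    have bdd: "bdd_below ((\<lambda>m. m f) ` C)" for f
    proof (cases "f \<in> V")
      case True
      then show ?thesis using convex_minorants_lower[OF q(1) CM] by (auto intro!: bdd_belowI2)
    next
      case False
      then have "m f = 0" if "m \<in> C" for m using CM[OF that] by (simp add: convex_minorants_def)
      then have "(\<lambda>m. m f) ` C \<subseteq> {0}" by blast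
      then show ?thesis by (rule bdd_below_mono[rotated]) simp
    qed
    define u where "u = (\<lambda>f. INF m\<in>C. m f)"
    have le: "u f \<le> m f" if "m \<in> C" for m f
      unfolding u_def using that bdd by (auto intro: cINF_lower)
    have const: "u f = 0" if "\<And>m. m \<in> C \<Longrightarrow> m f = 0" for f
    proof -
      have "(\<lambda>m. m f) ` C = (\<lambda>_. 0) ` C" by (rule image_cong) (auto intro: that)
      then show ?thesis unfolding u_def using False by simp
    qed
    have "convex_functional u"
      unfolding convex_functional_def
    proof (intro ballI)
      fix f g p assume fg: "f \<in> V" "g \<in> V" and p: "p \<in> {0..1::real}"
      show "u (\<lambda>z. p * f z + (1 - p) * g z) \<le> p * u f + (1 - p) * u g"
        unfolding u_def
      proof (rule Inf_le_convex_combination)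
        fix x y assume "x \<in> (\<lambda>m. m f) ` C" "y \<in> (\<lambda>m. m g) ` C"
        then obtain m1 m2 where m12: "m1 \<in> C" "x = m1 f" "m2 \<in> C" "y = m2 g" by auto
        \<comment> \<open>The functionals chosen for \<open>f\<close> and for \<open>g\<close> may
          differ, but in a chain the smaller of the two serves for both.\<close>
        obtain m where m: "m \<in> C" "m \<le> m1" "m \<le> m2" using total m12 by blast
        have "convex_functional m" using CM m(1) by (simp add: convex_minorants_def)
        then have "m (\<lambda>z. p * f z + (1 - p) * g z) \<le> p * m f + (1 - p) * m g"
          using convex_functionalD fg p by auto
        also have "\<dots> \<le> p * x + (1 - p) * y"
          using m m12 p by (intro add_mono mult_left_mono) (auto simp: le_fun_def)
        finally show "\<exists>z\<in>(\<lambda>m. m (\<lambda>z. p * f z + (1 - p) * g z)) ` C. z \<le> p * x + (1 - p) * y"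
          using m(1) by blast
      qed (use False bdd p in auto)
    qed
    moreover have "u (\<lambda>_. 0) = 0" by (rule const) (use CM in \<open>auto simp: convex_minorants_def\<close>)
    moreover have "u f \<le> q f" if f: "f \<in> V" for f
    proof -
      obtain m where m: "m \<in> C" using False by blast
      have "u f \<le> m f" using le m by blast
      also have "m f \<le> q f" using CM[OF m] f by (simp add: convex_minorants_def)
      finally show ?thesis .
    qed
    moreover have "u f = 0" if f: "f \<notin> V" for f
      by (rule const) (use CM f in \<open>auto simp: convex_minorants_def\<close>)
    ultimately have "u \<in> convex_minorants q" by (simp add: convex_minorants_def)
    then show ?thesis using le by (auto simp: le_fun_def)
  qed
qed

text \<open>A minimal convex functional is linear: if it were not, one of the smaller convex functionals
  \<open>f \<mapsto> m (t f) / t\<close> and \<open>f \<mapsto> inf {m (f + t g) - t m g | t \<ge> 0}\<close> would differ from it.\<close>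

lemma minimal_convex_minorant_linear:
  assumes m: "m \<in> convex_minorants q"
    and minimal: "\<And>m'. m' \<in> convex_minorants q \<Longrightarrow> m' \<le> m \<Longrightarrow> m' = m"
  shows "linear_functional m"
proof -
  have conv: "convex_functional m" and m0: "m (\<lambda>_. 0) = 0" and mq: "\<And>f. f \<in> V \<Longrightarrow> m f \<le> q f"
    and ext: "\<And>f. f \<notin> V \<Longrightarrow> m f = 0"
    using m by (auto simp: convex_minorants_def)
  \<comment> \<open>Minimality in usable form: a convex functional that vanishes at 0 and lies below
    \<open>m\<close> on \<open>V\<close> agrees with \<open>m\<close> there. Resetting it to 0
    outside \<open>V\<close> makes it a competitor.\<close>
  have eqI: "m' f = m f" if "convex_functional m'" "m' (\<lambda>_. 0) = 0" "\<And>f. f \<in> V \<Longrightarrow> m' f \<le> m f" "f \<in> V"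
    for m' f
  proof -
    let ?m = "\<lambda>f. if f \<in> V then m' f else 0"
    have "m' g \<le> q g" if "g \<in> V" for g using \<open>\<And>f. f \<in> V \<Longrightarrow> m' f \<le> m f\<close>[OF that] mq[OF that] by simp
    then have "?m \<in> convex_minorants q"
      using that by (auto simp: convex_minorants_def convex_functional_def zero_mem lincomb_mem)
    moreover have "?m \<le> m" using that ext by (auto simp: le_fun_def)
    ultimately have "?m = m" by (rule minimal)
    then have "?m f = m f" by (rule fun_cong)
    then show ?thesis using \<open>f \<in> V\<close> by simp
  qed
  have hom1: "m (\<lambda>z. t * f z) = t * m f" if t: "0 < t" "t \<le> 1" and f: "f \<in> V" for t f
  proof -
    have "m (\<lambda>z. t * f z) / t = m f"
    proof (rule eqI[where m' = "\<lambda>f. m (\<lambda>z. t * f z) / t"])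
      show "convex_functional (\<lambda>f. m (\<lambda>z. t * f z) / t)"
        unfolding convex_functional_def
      proof (intro ballI)
        fix f g p assume "f \<in> V" "g \<in> V" "p \<in> {0..1::real}"
        then have "m (\<lambda>z. p * (t * f z) + (1 - p) * (t * g z))
            \<le> p * m (\<lambda>z. t * f z) + (1 - p) * m (\<lambda>z. t * g z)"
          by (intro convex_functionalD[OF conv] scale_mem) auto
        then have "m (\<lambda>z. p * (t * f z) + (1 - p) * (t * g z)) / t
            \<le> (p * m (\<lambda>z. t * f z) + (1 - p) * m (\<lambda>z. t * g z)) / t"
          using t by (intro divide_right_mono) auto
        then show "m (\<lambda>z. t * (p * f z + (1 - p) * g z)) / t
            \<le> p * (m (\<lambda>z. t * f z) / t) + (1 - p) * (m (\<lambda>z. t * g z) / t)"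
          by (simp add: algebra_simps add_divide_distrib diff_divide_distrib)
      qed
      \<comment> \<open>Convexity between f and 0 with weight \<open>t\<close>; this is where t
        \<le> 1 enters.\<close>
      show "m (\<lambda>z. t * f z) / t \<le> m f" if "f \<in> V" for f
        using convex_functionalD[OF conv that zero_mem, of t] t m0 by (simp add: field_simps)
    qed (use m0 f in auto)
    then show ?thesis using t by (simp add: field_simps)
  qed
  have hom: "m (\<lambda>z. t * f z) = t * m f" if t: "0 \<le> t" and f: "f \<in> V" for t f
  proof -
    consider "t = 0" | "0 < t" "t \<le> 1" | "1 < t" using t by linarith
    then show ?thesis
    proof cases
      case 3
      then show ?thesis using hom1[of "1/t" "\<lambda>z. t * f z"] scale_mem[OF f, of t] by simp
    qed (use hom1 f m0 in auto)
  qed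
  have subadd: "m (\<lambda>z. f z + g z) \<le> m f + m g" if "f \<in> V" "g \<in> V" for f g
  proof -
    have "m (\<lambda>z. 1/2 * (f z + g z)) \<le> 1/2 * m f + 1/2 * m g"
      using convex_functionalD[OF conv that, of "1/2"] by (simp add: add_divide_distrib)
    then show ?thesis using hom[of "1/2" "\<lambda>z. f z + g z"] add_mem that by simp
  qed
  have add: "m (\<lambda>z. f z + g z) = m f + m g" if f: "f \<in> V" and g: "g \<in> V" for f g
  proof -
    \<comment> \<open>\<open>Inf (S f)\<close> moves in the direction \<open>g\<close> and subtracts
      the price \<open>t * m g\<close>. The value at t = 0 puts it below \<open>m\<close>, and the
      value at t = 1 will give additivity.\<close>
    define S where "S f = (\<lambda>t. m (\<lambda>z. f z + t * g z) - t * m g) ` {0..}" for f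
    have bdd: "bdd_below (S f)" if "f \<in> V" for f
      unfolding S_def
    proof (rule bdd_belowI2)
      fix t :: real assume "t \<in> {0..}"
      \<comment> \<open>Writing t g as (f + t g) - f, subadditivity gives a lower bound that is free
        of \<open>t\<close>.\<close>
      then have "t * m g = m (\<lambda>z. (f z + t * g z) + - f z)" using hom g by simp
      also have "\<dots> \<le> m (\<lambda>z. f z + t * g z) + m (\<lambda>z. - f z)"
        using that g by (intro subadd uminus_mem add_mem scale_mem)
      finally show "- m (\<lambda>z. - f z) \<le> m (\<lambda>z. f z + t * g z) - t * m g" by simp
    qed
    have le: "Inf (S f) \<le> m (\<lambda>z. f z + t * g z) - t * m g" if "f \<in> V" "0 \<le> t" for f t
      using bdd[OF that(1)] that(2) by (intro cInf_lower) (auto simp: S_def)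
    have "Inf (S f) = m f"
    proof (rule eqI[where m' = "\<lambda>f. Inf (S f)"])
      show "convex_functional (\<lambda>f. Inf (S f))"
        unfolding convex_functional_def
      proof (intro ballI)
        fix f1 f2 p assume f12: "f1 \<in> V" "f2 \<in> V" and p: "p \<in> {0..1::real}"
        show "Inf (S (\<lambda>z. p * f1 z + (1 - p) * f2 z)) \<le> p * Inf (S f1) + (1 - p) * Inf (S f2)"
        proof (rule Inf_le_convex_combination)
          fix x y assume "x \<in> S f1" "y \<in> S f2"
          then obtain t1 t2 where t: "0 \<le> t1" "x = m (\<lambda>z. f1 z + t1 * g z) - t1 * m g"
            "0 \<le> t2" "y = m (\<lambda>z. f2 z + t2 * g z) - t2 * m g" by (auto simp: S_def)
          \<comment> \<open>Mixing the two shifts with the weights of \<open>f1\<close> and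
            \<open>f2\<close> makes both the argument of \<open>m\<close> and the subtracted price
            convex combinations.\<close>
          let ?t = "p * t1 + (1 - p) * t2"
          have "m (\<lambda>z. p * (f1 z + t1 * g z) + (1 - p) * (f2 z + t2 * g z))
            \<le> p * m (\<lambda>z. f1 z + t1 * g z) + (1 - p) * m (\<lambda>z. f2 z + t2 * g z)"
            using p f12 g by (intro convex_functionalD[OF conv] add_mem scale_mem) auto
          moreover have "(\<lambda>z. p * (f1 z + t1 * g z) + (1 - p) * (f2 z + t2 * g z))
              = (\<lambda>z. (p * f1 z + (1 - p) * f2 z) + ?t * g z)"
            by (simp add: algebra_simps)
          moreover have "p * x + (1 - p) * y
              = p * m (\<lambda>z. f1 z + t1 * g z) + (1 - p) * m (\<lambda>z. f2 z + t2 * g z) - ?t * m g"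
            unfolding t by (simp only: algebra_simps)
          ultimately have "m (\<lambda>z. (p * f1 z + (1 - p) * f2 z) + ?t * g z) - ?t * m g \<le> p * x + (1 - p) * y"
            by simp
          moreover have "0 \<le> ?t" using t p by auto
          ultimately show "\<exists>z\<in>S (\<lambda>z. p * f1 z + (1 - p) * f2 z). z \<le> p * x + (1 - p) * y"
            unfolding S_def by blast
        qed (use p f12 in \<open>auto simp: S_def[of f1] S_def[of f2] intro: bdd lincomb_mem\<close>)
      qed
      have "S (\<lambda>_. 0) = {0}" using hom g by (force simp: S_def)
      then show "Inf (S (\<lambda>_. 0)) = 0" by simp
      show "Inf (S f) \<le> m f" if "f \<in> V" for f using le[OF that, of 0] by simp
    qed fact
    \<comment> \<open>By minimality m f = Inf (S f) \<le> m (f + g) - m g, the inequality opposite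
      to subadditivity.\<close>
    then show ?thesis using le[OF f, of 1] subadd[OF f g] by simp
  qed
  have neg: "m (\<lambda>z. - f z) = - m f" if "f \<in> V" for f
    using add[OF that uminus_mem[OF that]] m0 by simp
  have scale: "m (\<lambda>z. t * f z) = t * m f" if f: "f \<in> V" for t f
  proof (cases "0 \<le> t")
    case False
    then show ?thesis using hom[of "-t" "\<lambda>z. - f z"] uminus_mem[OF f] neg[OF f] by simp
  qed (use hom f in auto)
  show ?thesis
    unfolding linear_functional_def using add scale scale_mem by simp
qed

theorem Hahn_Banach_convex:
  assumes "convex_functional q" "q (\<lambda>_. 0) = 0"
  obtains L where "linear_functional L" "\<And>f. f \<in> V \<Longrightarrow> L f \<le> q f"
proof -
  obtain m where m: "m \<in> convex_minorants q"
    and "\<forall>m'\<in>convex_minorants q. m' \<le> m \<longrightarrow> m' = m"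
    using convex_minorants_minimal[OF assms] by blast
  then have "linear_functional m" by (intro minimal_convex_minorant_linear[OF m]) auto
  then show thesis using m that by (auto simp: convex_minorants_def)
qed

end

subsection \<open>Daniell functionals\<close>

locale function_lattice = function_space V for V :: "('a \<Rightarrow> real) set" +
  assumes one_mem: "(\<lambda>_. 1) \<in> V"
    and max_mem: "f \<in> V \<Longrightarrow> g \<in> V \<Longrightarrow> (\<lambda>z. max (f z) (g z)) \<in> V"
begin

lemma const_mem: "(\<lambda>_. c) \<in> V"
  using scale_mem[OF one_mem, of c] by simp

lemma min_mem: "f \<in> V \<Longrightarrow> g \<in> V \<Longrightarrow> (\<lambda>z. min (f z) (g z)) \<in> V"
  using uminus_mem[OF max_mem[OF uminus_mem uminus_mem, of f g]]
  by (simp add: minus_max_eq_min)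

text \<open>Closed under intersection, since \<open>V\<close> is closed under minima, and a
  generator of the smallest \<sigma>-algebra that makes all of \<open>V\<close> measurable.\<close>

definition positivity_sets :: "'a set set" where
  "positivity_sets = {{z. 0 < f z} | f. f \<in> V}"

definition generated :: "'a measure" where
  "generated = sigma UNIV positivity_sets"

lemma space_generated [simp]: "space generated = UNIV"
  by (simp add: generated_def)

lemma sets_generated: "sets generated = sigma_sets UNIV positivity_sets"
  by (simp add: generated_def)

lemma positive_set_in_generated: "f \<in> V \<Longrightarrow> {z. 0 < f z} \<in> sets generated"
  unfolding sets_generated positivity_sets_def by (rule sigma_sets.Basic) blast

lemma borel_measurable_generated: "f \<in> V \<Longrightarrow> f \<in> borel_measurable generated"
  using positive_set_in_generated[OF diff_mem[OF _ const_mem]]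
  by (auto simp: borel_measurable_iff_greater)

text \<open>Members of \<open>V\<close> with values in [0, 1] that increase to the indicator of {f >
  0}, which itself need not lie in \<open>V\<close>.\<close>

definition ramp :: "('a \<Rightarrow> real) \<Rightarrow> nat \<Rightarrow> 'a \<Rightarrow> real" where
  "ramp f n = (\<lambda>z. max 0 (min 1 (real n * f z)))"

lemma ramp_mem: "f \<in> V \<Longrightarrow> ramp f n \<in> V"
  unfolding ramp_def by (intro max_mem min_mem const_mem scale_mem)

lemma ramp_nonneg: "0 \<le> ramp f n z"
  by (simp add: ramp_def)

lemma ramp_tendsto: "(\<lambda>n. ramp f n z) \<longlonglongrightarrow> indicator {z. 0 < f z} z"
proof (cases "0 < f z")
  case True
  obtain N :: nat where "1 / f z \<le> real N" using real_arch_simple by blast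
  then have "1 \<le> real N * f z" using True by (simp add: field_simps)
  moreover have "real N * f z \<le> real n * f z" if "N \<le> n" for n
    using True that by (intro mult_right_mono) auto
  ultimately have "1 \<le> real n * f z" if "N \<le> n" for n using that by force
  then have "\<forall>\<^sub>F n in sequentially. ramp f n z = 1"
    unfolding ramp_def eventually_sequentially by (intro exI[of _ N]) auto
  then show ?thesis using True by (simp add: tendsto_eventually)
next
  case False
  then have "real n * f z \<le> 0" for n by (simp add: mult_nonneg_nonpos)
  then have "min 1 (real n * f z) \<le> 0" for n by (simp add: min.coboundedI2)
  then have "ramp f n z = 0" for n
    unfolding ramp_def by (rule max_absorb1)
  then show ?thesis using False by simp
qed

text \<open>Dominated convergence along ramps turns equal integrals into equal measures of the sets
  {f > 0}, which form an intersection-stable generator.\<close>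

lemma measure_eqI_lattice:
  fixes M N :: "'a measure"
  assumes "prob_space M" "prob_space N"
    and sets: "sets M = sets generated" "sets N = sets generated"
    and eq: "\<And>f. f \<in> V \<Longrightarrow> (\<integral>z. f z \<partial>M) = (\<integral>z. f z \<partial>N)"
  shows "M = N"
proof (rule measure_eqI_generator_eq[where E = positivity_sets and \<Omega> = UNIV and A = "\<lambda>_. UNIV"])
  have lim: "(\<lambda>n. \<integral>z. ramp f n z \<partial>K) \<longlonglongrightarrow> measure K {z. 0 < f z}"
    if "prob_space K" "sets K = sets generated" "f \<in> V" for K :: "'a measure" and f
  proof -
    interpret K: prob_space K by fact
    have meas: "g \<in> borel_measurable K" if "g \<in> V" for g
      using borel_measurable_generated[OF that] \<open>sets K = sets generated\<close>
      by (simp cong: measurable_cong_sets)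
    have set: "{z. 0 < f z} \<in> sets K" using positive_set_in_generated that by simp
    have "(\<lambda>n. \<integral>z. ramp f n z \<partial>K) \<longlonglongrightarrow> (\<integral>z. indicator {z. 0 < f z} z \<partial>K)"
    proof (rule integral_dominated_convergence[where w = "\<lambda>_. 1"])
      show "AE z in K. (\<lambda>n. ramp f n z) \<longlonglongrightarrow> indicator {z. 0 < f z} z" by (simp add: ramp_tendsto)
      show "AE z in K. norm (ramp f n z) \<le> 1" for n by (simp add: ramp_def)
    qed (use meas ramp_mem that set in auto)
    then show ?thesis using set by simp
  qed
  fix X assume "X \<in> positivity_sets"
  then obtain f where f: "f \<in> V" "X = {z. 0 < f z}" by (auto simp: positivity_sets_def)
  have "measure M X = measure N X"
    using LIMSEQ_unique[OF lim[OF assms(1) sets(1) f(1)]] lim[OF assms(2) sets(2) f(1)]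
      eq[OF ramp_mem[OF f(1)]] f(2) by simp
  then show "emeasure M X = emeasure N X"
    by (simp add: assms(1,2) finite_measure.emeasure_eq_measure prob_space.finite_measure)
next
  show "Int_stable positivity_sets"
    unfolding Int_stable_def positivity_sets_def
  proof safe
    fix f g assume "f \<in> V" "g \<in> V"
    then show "\<exists>h. {z. 0 < f z} \<inter> {z. 0 < g z} = {z. 0 < h z} \<and> h \<in> V"
      by (intro exI[of _ "\<lambda>z. min (f z) (g z)"]) (auto intro: min_mem)
  qed
  have "UNIV \<in> positivity_sets"
    unfolding positivity_sets_def using one_mem by (intro CollectI exI[of _ "\<lambda>_. 1"]) simp
  then show "range (\<lambda>_. UNIV) \<subseteq> positivity_sets" by blast
  show "emeasure M UNIV \<noteq> \<infinity>" for i :: nat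
    using finite_measure.emeasure_finite[OF prob_space.finite_measure[OF assms(1)]] by simp
qed (use sets in \<open>auto simp: sets_generated\<close>)

end

text \<open>Daniell's representation theorem, following the proof that extends the premeasure
  \<open>L (g - f)\<close> of the band between the graphs of \<open>f \<le> g\<close>: countable additivity follows by
  measuring the fibres of the bands with the Lebesgue measure.\<close>

definition band :: "('a \<Rightarrow> real) \<Rightarrow> ('a \<Rightarrow> real) \<Rightarrow> ('a \<times> real) set" where
  "band f g = {(z, t). f z \<le> t \<and> t < g z}"

lemma mem_band [simp]: "(z, t) \<in> band f g \<longleftrightarrow> f z \<le> t \<and> t < g z"
  by (simp add: band_def)

text \<open>On a fibre the two intervals may be disjoint. The outer \<open>max\<close> then empties
  the band while its upper graph stays above its lower graph, as membership in the semiring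
  demands.\<close>

lemma band_Int:
  "band f g \<inter> band f' g'
    = band (\<lambda>z. max (f z) (f' z)) (\<lambda>z. max (max (f z) (f' z)) (min (g z) (g' z)))"
  by (auto simp: max_def min_def split: if_splits)

text \<open>Each fibre loses an interval, which leaves a piece below \<open>f'\<close> and a piece
  from \<open>g'\<close> upwards. Clamping the cut points between \<open>f\<close> and
  \<open>g\<close> allows either piece to be empty and uses lattice operations only.\<close>

lemma band_Diff:
  assumes "\<And>z. f z \<le> g z"
  shows "band f g - band f' g'
    = band f (\<lambda>z. max (f z) (min (g z) (f' z))) \<union> band (\<lambda>z. min (g z) (max (f z) (g' z))) g"
  using assms by (auto simp: max_def min_def split: if_splits)

section \<open>Construction of the representing measure\<close>

locale Daniell_functional = function_lattice V for V :: "('a \<Rightarrow> real) set" +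
  fixes L :: "('a \<Rightarrow> real) \<Rightarrow> real"
  assumes linear: "linear_functional L"
    and nonneg: "f \<in> V \<Longrightarrow> (\<And>z. 0 \<le> f z) \<Longrightarrow> 0 \<le> L f"
    and tendsto_zero: "(\<And>n. F n \<in> V) \<Longrightarrow> (\<And>n z. F (Suc n) z \<le> F n z)
      \<Longrightarrow> (\<And>z. (\<lambda>n. F n z) \<longlonglongrightarrow> 0) \<Longrightarrow> (\<lambda>n. L (F n)) \<longlonglongrightarrow> 0"
    and one: "L (\<lambda>_. 1) = 1"
begin

lemma lincomb: "f \<in> V \<Longrightarrow> g \<in> V \<Longrightarrow> L (\<lambda>z. a * f z + b * g z) = a * L f + b * L g"
  using linear by (simp add: linear_functional_def)

lemma scale: "f \<in> V \<Longrightarrow> L (\<lambda>z. a * f z) = a * L f"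
  using lincomb[of f f a 0] by simp

lemma add: "f \<in> V \<Longrightarrow> g \<in> V \<Longrightarrow> L (\<lambda>z. f z + g z) = L f + L g"
  using lincomb[of f g 1 1] by simp

lemma diff: "f \<in> V \<Longrightarrow> g \<in> V \<Longrightarrow> L (\<lambda>z. f z - g z) = L f - L g"
  using lincomb[of f g 1 "-1"] by simp

lemma at_zero: "L (\<lambda>_. 0) = 0"
  using scale[OF zero_mem, of 0] by simp

lemma sum: "(\<And>i. i \<in> I \<Longrightarrow> f i \<in> V) \<Longrightarrow> L (\<lambda>z. \<Sum>i\<in>I. f i z) = (\<Sum>i\<in>I. L (f i))"
  by (induction I rule: infinite_finite_induct) (auto simp: at_zero add sum_mem)

definition bands :: "('a \<times> real) measure" where
  "bands = extend_measure UNIV {(f, g). f \<in> V \<and> g \<in> V \<and> (\<forall>z. f z \<le> g z)}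
     (\<lambda>(f, g). band f g) (\<lambda>(f, g). ennreal (L (\<lambda>z. g z - f z)))"

lemma semiring_of_bands:
  "semiring_of_sets UNIV {band f g | f g. f \<in> V \<and> g \<in> V \<and> (\<forall>z. f z \<le> g z)}"
proof (unfold_locales, safe)
  let ?B = "{band f g | f g. f \<in> V \<and> g \<in> V \<and> (\<forall>z. f z \<le> g z)}"
  have "{} = band (\<lambda>_ :: 'a. 0) (\<lambda>_. 0)" by auto
  then show "\<exists>f g. {} = band f g \<and> f \<in> V \<and> g \<in> V \<and> (\<forall>z. f z \<le> g z)" using zero_mem by blast
  fix f g f' g' assume V: "f \<in> V" "g \<in> V" "f' \<in> V" "g' \<in> V"
    and le: "\<forall>z. f z \<le> g z" "\<forall>z. f' z \<le> g' z"
  show "\<exists>k l. band f g \<inter> band f' g' = band k l \<and> k \<in> V \<and> l \<in> V \<and> (\<forall>z. k z \<le> l z)"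
    using V by (intro exI[of _ "\<lambda>z. max (f z) (f' z)"]
        exI[of _ "\<lambda>z. max (max (f z) (f' z)) (min (g z) (g' z))"])
      (auto simp: band_Int intro!: max_mem min_mem)
  let ?A = "band f (\<lambda>z. max (f z) (min (g z) (f' z)))"
  let ?B' = "band (\<lambda>z. min (g z) (max (f z) (g' z))) g"
  have "?A \<in> ?B" "?B' \<in> ?B"
    using V le by (auto intro!: exI max_mem min_mem)
  moreover have "?A \<inter> ?B' = {}"
  proof (rule equals0I)
    fix w assume "w \<in> ?A \<inter> ?B'"
    moreover obtain z t where "w = (z, t)" by force
    ultimately show False
      using le[rule_format, of z] by (auto simp: less_max_iff_disj min_le_iff_disj)
  qed
  ultimately show "\<exists>C\<subseteq>?B. finite C \<and> disjoint C \<and> band f g - band f' g' = \<Union>C"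
    using band_Diff[of f g f' g'] le
    by (intro exI[of _ "{?A, ?B'}"]) (auto simp: disjoint_def)
qed (rule UNIV_I)

lemma emeasure_band:
  assumes V: "f \<in> V" "g \<in> V" and le: "\<And>z. f z \<le> g z"
  shows "emeasure bands (band f g) = ennreal (L (\<lambda>z. g z - f z))"
proof (rule extend_measure_caratheodory_pair[OF bands_def])
  show "f \<in> V \<and> g \<in> V \<and> (\<forall>z. f z \<le> g z)" using assms by blast
  show "semiring_of_sets UNIV {band f g |f g. f \<in> V \<and> g \<in> V \<and> (\<forall>z. f z \<le> g z)}"
    by (rule semiring_of_bands)
  have fibre: "{t. (z, t) \<in> band f g} = {f z..<g z}" for z f g
    by auto
  have len: "emeasure lborel {t. (z, t) \<in> band f g} = ennreal (g z - f z)" if "f z \<le> g z"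
    for z and f g :: "'a \<Rightarrow> real"
    unfolding fibre using that by simp
  \<comment> \<open>The premeasure is attached to a pair of graphs and must be shown to depend on
    the band alone; the lengths of the fibres recover the difference of the graphs.\<close>
  show inj: "ennreal (L (\<lambda>z. g z - f z)) = ennreal (L (\<lambda>z. l z - k z))"
    if "f \<in> V \<and> g \<in> V \<and> (\<forall>z. f z \<le> g z)" "k \<in> V \<and> l \<in> V \<and> (\<forall>z. k z \<le> l z)"
      "band f g = band k l" for f g k l
  proof -
    have "g z - f z = l z - k z" for z
      using len[of f z g] len[of k z l] that by simp
    then show ?thesis by simp
  qed
  show "ennreal (L (\<lambda>z. g z - f z)) = 0"
    if "f \<in> V \<and> g \<in> V \<and> (\<forall>z. f z \<le> g z)" "band f g = {}" for f g
  proof -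
    have "band f g = band (\<lambda>_. 0) (\<lambda>_. 0)" using that by auto
    then show ?thesis using inj[of f g "\<lambda>_. 0" "\<lambda>_. 0"] that zero_mem at_zero by simp
  qed
  show "0 \<le> ennreal (L (\<lambda>z. g z - f z))" for f g by simp
  fix A B :: "nat \<Rightarrow> 'a \<Rightarrow> real" and k l :: "'a \<Rightarrow> real"
  assume AB: "\<And>n. A n \<in> V \<and> B n \<in> V \<and> (\<forall>z. A n z \<le> B n z)"
    and kl: "k \<in> V \<and> l \<in> V \<and> (\<forall>z. k z \<le> l z)"
    and disj: "disjoint_family (\<lambda>n. band (A n) (B n))"
    and un: "(\<Union>n. band (A n) (B n)) = band k l"
  have sums: "(\<lambda>n. B n z - A n z) sums (l z - k z)" for z
  proof -
    have "(\<Sum>n. emeasure lborel {t. (z, t) \<in> band (A n) (B n)})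
        = emeasure lborel (\<Union>n. {t. (z, t) \<in> band (A n) (B n)})"
    proof (rule suminf_emeasure)
      show "range (\<lambda>n. {t. (z, t) \<in> band (A n) (B n)}) \<subseteq> sets lborel"
        unfolding fibre by auto
      show "disjoint_family (\<lambda>n. {t. (z, t) \<in> band (A n) (B n)})"
        using disj unfolding disjoint_family_on_def by blast
    qed
    also have "(\<Union>n. {t. (z, t) \<in> band (A n) (B n)}) = {t. (z, t) \<in> band k l}"
      using un by blast
    finally have "(\<Sum>n. ennreal (B n z - A n z)) = ennreal (l z - k z)"
      using len AB kl by simp
    then have "(\<lambda>n. ennreal (B n z - A n z)) sums ennreal (l z - k z)"
      by (metis summableI summable_sums)
    then show ?thesis using AB kl by (subst (asm) sums_ennreal) auto
  qed
  \<comment> \<open>The height not yet exhausted by the first \<open>n\<close> bands. It lies in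
    \<open>V\<close> and decreases to 0, so the continuity of \<open>L\<close> turns the pointwise
    sum into a sum of values of \<open>L\<close>.\<close>
  define R where "R n = (\<lambda>z. (l z - k z) - (\<Sum>i<n. B i z - A i z))" for n
  have "(\<lambda>n. L (R n)) \<longlonglongrightarrow> 0"
  proof (rule tendsto_zero)
    show "R n \<in> V" for n
      unfolding R_def using AB kl by (intro diff_mem sum_mem) auto
    show "R (Suc n) z \<le> R n z" for n z
      using AB by (simp add: R_def)
    show "(\<lambda>n. R n z) \<longlonglongrightarrow> 0" for z
      using tendsto_diff[OF tendsto_const[of "l z - k z"] sums[of z, unfolded sums_def]] by (simp add: R_def)
  qed
  moreover have "L (R n) = L (\<lambda>z. l z - k z) - (\<Sum>i<n. L (\<lambda>z. B i z - A i z))" for n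
  proof -
    have "L (R n) = L (\<lambda>z. l z - k z) - L (\<lambda>z. \<Sum>i<n. B i z - A i z)"
      unfolding R_def using AB kl by (intro diff diff_mem sum_mem) auto
    also have "L (\<lambda>z. \<Sum>i<n. B i z - A i z) = (\<Sum>i<n. L (\<lambda>z. B i z - A i z))"
      using AB by (intro sum diff_mem) auto
    finally show ?thesis .
  qed
  ultimately have "(\<lambda>n. L (\<lambda>z. l z - k z) - (\<Sum>i<n. L (\<lambda>z. B i z - A i z))) \<longlonglongrightarrow> 0" by simp
  then have "(\<lambda>n. L (\<lambda>z. B n z - A n z)) sums L (\<lambda>z. l z - k z)"
    using tendsto_diff[OF tendsto_const[of "L (\<lambda>z. l z - k z)"]] unfolding sums_def by fastforce
  moreover have "0 \<le> L (\<lambda>z. B n z - A n z)" for n using AB by (intro nonneg diff_mem) auto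
  moreover have "0 \<le> L (\<lambda>z. l z - k z)" using kl by (intro nonneg diff_mem) auto
  ultimately show "(\<Sum>n. ennreal (L (\<lambda>z. B n z - A n z))) = ennreal (L (\<lambda>z. l z - k z))"
    by (intro sums_unique[symmetric]) simp
qed

lemma space_bands [simp]: "space bands = UNIV"
  unfolding bands_def by (rule space_extend_measure) simp

lemma band_in_bands: "f \<in> V \<Longrightarrow> g \<in> V \<Longrightarrow> (\<And>z. f z \<le> g z) \<Longrightarrow> band f g \<in> sets bands"
  unfolding bands_def by (subst sets_extend_measure) (auto intro!: sigma_sets.Basic)

text \<open>Over {f > 0} the slab is the union of the bands under the ramps. The interval has to be
  open at 1: every height t < 1 is exceeded by some ramp, but no ramp exceeds 1. Complements are
  taken within the unit slab, itself a band.\<close>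

lemma times_in_bands:
  assumes "A \<in> sets generated"
  shows "A \<times> {0..<1} \<in> sets bands"
proof -
  have unit: "UNIV \<times> {0..<1} = band (\<lambda>_ :: 'a. 0) (\<lambda>_. 1)" by auto
  have unit_in: "(UNIV :: 'a set) \<times> {0..<1::real} \<in> sets bands"
    unfolding unit by (intro band_in_bands const_mem) auto
  from assms show ?thesis
    unfolding sets_generated
  proof (induction rule: sigma_sets.induct)
    case (Basic X)
    then obtain f where f: "f \<in> V" "X = {z. 0 < f z}" by (auto simp: positivity_sets_def)
    have "X \<times> {0..<1} = (\<Union>n. band (\<lambda>_. 0) (ramp f n))"
    proof (intro equalityI subsetI)
      fix w :: "'a \<times> real" assume "w \<in> X \<times> {0..<1}"
      then obtain z and t :: real where w: "w = (z, t)" "0 < f z" "0 \<le> t" "t < 1" using f by auto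
      then have "\<forall>\<^sub>F n in sequentially. t < ramp f n z"
        using order_tendstoD(1)[OF ramp_tendsto[of f z], of t] by simp
      then obtain n where "t < ramp f n z" by (auto simp: eventually_sequentially)
      then show "w \<in> (\<Union>n. band (\<lambda>_. 0) (ramp f n))" using w by auto
    next
      fix w :: "'a \<times> real" assume "w \<in> (\<Union>n. band (\<lambda>_. 0) (ramp f n))"
      then obtain n where "w \<in> band (\<lambda>_. 0) (ramp f n)" by blast
      moreover obtain z t where w: "w = (z, t)" by (rule prod.exhaust)
      ultimately have t: "0 \<le> t" "t < ramp f n z" by simp_all
      then have "0 < real n * f z" "t < 1" unfolding ramp_def by (auto simp: max_def min_def split: if_splits)
      then show "w \<in> X \<times> {0..<1}" using w t f by (auto simp: zero_less_mult_iff)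
    qed
    also have "\<dots> \<in> sets bands"
      using f by (intro sets.countable_UN) (auto intro!: band_in_bands zero_mem ramp_mem ramp_nonneg)
    finally show ?case .
  next
    case (Compl A)
    have "(UNIV - A) \<times> {0..<1::real} = UNIV \<times> {0..<1} - A \<times> {0..<1}" by auto
    then show ?case using unit_in Compl by (metis sets.Diff)
  next
    case (Union A)
    have "(\<Union>i. A i) \<times> {0..<1::real} = (\<Union>i. A i \<times> {0..<1})" by auto
    then show ?case using Union by auto
  qed simp
qed

text \<open>A set is measured by the slab of height 1 over it, which brings the measure on bands
  down to the base.\<close>

definition representing :: "'a measure" where
  "representing = distr (restrict_space bands (UNIV \<times> {0..<1})) generated fst"

lemma sets_representing [simp]: "sets representing = sets generated"
  by (simp add: representing_def)

lemma space_representing [simp]: "space representing = UNIV"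
  by (simp add: representing_def)

lemma emeasure_representing:
  assumes "A \<in> sets generated"
  shows "emeasure representing A = emeasure bands (A \<times> {0..<1})"
proof -
  have unit: "(UNIV :: 'a set) \<times> {0..<1::real} \<in> sets bands"
    using times_in_bands[OF sets.top[of generated]] by simp
  have vim: "fst -` B \<inter> (UNIV \<times> {0..<1}) = B \<times> {0..<1::real}" for B :: "'a set" by auto
  have "fst \<in> measurable (restrict_space bands (UNIV \<times> {0..<1})) generated"
  proof (rule measurableI)
    fix B assume "B \<in> sets generated"
    then show "fst -` B \<inter> space (restrict_space bands (UNIV \<times> {0..<1})) \<in> sets (restrict_space bands (UNIV \<times> {0..<1}))"
      using times_in_bands unit by (subst sets_restrict_space_iff) (auto simp: space_restrict_space vim)
  qed auto
  then show ?thesis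
    unfolding representing_def using assms unit
    by (simp add: emeasure_distr space_restrict_space vim)
      (subst emeasure_restrict_space, auto)
qed

lemma emeasure_under_graph:
  assumes "h \<in> V" "\<And>z. 0 \<le> h z"
  shows "emeasure bands (band (\<lambda>_. 0) h) = ennreal (L h)"
  using emeasure_band[OF zero_mem assms] by simp

sublocale prob_space representing
proof
  have "(UNIV :: 'a set) \<times> {0..<1::real} = band (\<lambda>_. 0) (\<lambda>_. 1)" by auto
  then show "emeasure representing (space representing) = 1"
    using emeasure_representing[OF sets.top[of generated]] emeasure_under_graph[OF one_mem] one by simp
qed

lemma borel_measurable_representing: "f \<in> V \<Longrightarrow> f \<in> borel_measurable representing"
  using borel_measurable_generated by (simp cong: measurable_cong_sets)

text \<open>The band under \<open>h\<close> lies in the slab over \<open>A\<close>. Together with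
  \<open>measure_le\<close>, this compares \<open>L\<close> with the measure before any integral
  appears.\<close>

lemma le_measure:
  assumes "h \<in> V" "\<And>z. 0 \<le> h z" "A \<in> sets generated" "\<And>z. h z \<le> indicator A z"
  shows "L h \<le> measure representing A"
proof -
  have "band (\<lambda>_. 0) h \<subseteq> A \<times> {0..<1}"
  proof clarify
    fix z t assume "(z, t) \<in> band (\<lambda>_. 0) h"
    then show "z \<in> A \<and> t \<in> {0..<1}" using assms(4)[of z] by (cases "z \<in> A") auto
  qed
  then have "ennreal (L h) \<le> emeasure representing A"
    unfolding emeasure_representing[OF assms(3)] emeasure_under_graph[OF assms(1,2), symmetric]
    by (rule emeasure_mono) (rule times_in_bands[OF assms(3)])
  then show ?thesis by (simp add: emeasure_eq_measure)
qed

lemma measure_le: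
  assumes "h \<in> V" "A \<in> sets generated" "\<And>z. indicator A z \<le> h z"
  shows "measure representing A \<le> L h"
proof -
  have h0: "0 \<le> h z" for z using assms(3)[of z] by (cases "z \<in> A") auto
  have "A \<times> {0..<1} \<subseteq> band (\<lambda>_. 0) h"
  proof clarify
    fix z t assume "z \<in> A" "t \<in> {0..<1::real}"
    then show "(z, t) \<in> band (\<lambda>_. 0) h" using assms(3)[of z] by auto
  qed
  then have "emeasure representing A \<le> ennreal (L h)"
    unfolding emeasure_representing[OF assms(2)] emeasure_under_graph[OF assms(1) h0, symmetric]
    by (rule emeasure_mono) (intro band_in_bands zero_mem assms(1) h0)
  then show ?thesis using nonneg[OF assms(1) h0] by (simp add: emeasure_eq_measure)
qed

text \<open>Slicing \<open>h\<close> at the heights \<open>k / n\<close> determines both sides up to an error \<open>1 / n\<close>.\<close>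

lemma representing_unit:
  assumes h: "h \<in> V" "\<And>z. 0 \<le> h z" "\<And>z. h z \<le> 1"
  shows "L h = (\<integral>z. h z \<partial>representing)"
proof -
  have int: "integrable representing f" if "f \<in> V" "\<And>z. 0 \<le> f z" "\<And>z. f z \<le> 1" for f
    using that borel_measurable_representing by (intro integrable_const_bound[of _ 1]) auto
  have approx: "real n * \<bar>L h - (\<integral>z. h z \<partial>representing)\<bar> \<le> 1" if n: "0 < n" for n :: nat
  proof -
    \<comment> \<open>\<open>n\<close> times the part of \<open>h\<close> between the heights k/n
      and (k+1)/n. It lies between the indicators of h \<ge> (k+1)/n and h \<ge> k/n, and the slices
      with k < n add up to n h.\<close>
    define s where "s k = (\<lambda>z. real n * (min (h z) (real (Suc k) / real n) - min (h z) (real k / real n)))" for k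
    define a where "a k = measure representing {z. real k / real n \<le> h z}" for k
    have s: "s k \<in> V" for k unfolding s_def using h by (intro scale_mem diff_mem min_mem const_mem)
    have s01: "0 \<le> s k z" "s k z \<le> 1" for k z
      using n by (auto simp: s_def min_def field_simps)
    have A: "{z. real k / real n \<le> h z} \<in> sets generated" for k
    proof -
      have "{z \<in> space generated. real k / real n \<le> h z} \<in> sets generated"
        using borel_measurable_generated[OF h(1)] by measurable
      then show ?thesis by simp
    qed
    have heights: "real k / real n \<le> real (Suc k) / real n" for k
      by (intro divide_right_mono) auto
    have upper: "s k z \<le> indicator {z. real k / real n \<le> h z} z" for k z
      using s01[of k z] heights[of k] by (cases "real k / real n \<le> h z") (auto simp: s_def min_def)
    have lower: "indicator {z. real (Suc k) / real n \<le> h z} z \<le> s k z" for k z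
    proof (cases "real (Suc k) / real n \<le> h z")
      case True
      then have "s k z = real n * (real (Suc k) / real n - real k / real n)"
        using heights[of k] by (simp add: s_def)
      also have "\<dots> = 1" using n by (simp add: field_simps)
      finally show ?thesis by (simp add: indicator_def)
    qed (simp add: s01)
    \<comment> \<open>Both numbers lie between \<open>a (Suc k)\<close> and \<open>a k\<close>: the
      value of \<open>L\<close> by comparing bands, the integral by monotonicity.\<close>
    have slice: "\<bar>L (s k) - (\<integral>z. s k z \<partial>representing)\<bar> \<le> a k - a (Suc k)" for k
    proof -
      have "L (s k) \<le> a k" unfolding a_def using s s01 A upper by (intro le_measure)
      moreover have "a (Suc k) \<le> L (s k)" unfolding a_def using s A lower by (intro measure_le)
      moreover have ind: "integrable representing (indicator {z. real k / real n \<le> h z} :: 'a \<Rightarrow> real)" for k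
        using A by (intro integrable_real_indicator) (auto simp: emeasure_eq_measure)
      moreover have "(\<integral>z. s k z \<partial>representing) \<le> (\<integral>z. indicator {z. real k / real n \<le> h z} z \<partial>representing)"
        using upper by (intro integral_mono int[OF s s01] ind)
      moreover have "(\<integral>z. indicator {z. real (Suc k) / real n \<le> h z} z \<partial>representing) \<le> (\<integral>z. s k z \<partial>representing)"
        using lower by (intro integral_mono int[OF s s01] ind)
      ultimately show ?thesis using A[of k] A[of "Suc k"] by (simp add: a_def)
    qed
    have nh: "(\<Sum>k<n. s k z) = real n * h z" for z
    proof -
      have "(\<Sum>k<n. s k z) = real n * (min (h z) (real n / real n) - min (h z) (real 0 / real n))"
        unfolding s_def sum_distrib_left[symmetric] by (subst sum_lessThan_telescope) simp
      moreover have "min (h z) 1 = h z" "min (h z) 0 = 0" using h(2,3)[of z] by (simp_all add: min_absorb1 min_absorb2)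
      ultimately show ?thesis using n by simp
    qed
    have "real n * (L h - (\<integral>z. h z \<partial>representing))
        = L (\<lambda>z. \<Sum>k<n. s k z) - (\<integral>z. (\<Sum>k<n. s k z) \<partial>representing)"
      unfolding nh using h by (simp add: scale right_diff_distrib)
    also have "\<dots> = (\<Sum>k<n. L (s k) - (\<integral>z. s k z \<partial>representing))"
      using sum[of "{..<n}" s, OF s] int[OF s s01]
      by (simp only: Bochner_Integration.integral_sum sum_subtractf)
    finally have "\<bar>real n * (L h - (\<integral>z. h z \<partial>representing))\<bar>
        = \<bar>\<Sum>k<n. L (s k) - (\<integral>z. s k z \<partial>representing)\<bar>"
      by (rule arg_cong)
    then have "real n * \<bar>L h - (\<integral>z. h z \<partial>representing)\<bar>
        = \<bar>\<Sum>k<n. L (s k) - (\<integral>z. s k z \<partial>representing)\<bar>"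
      by (simp only: abs_mult abs_of_nat)
    also have "\<dots> \<le> (\<Sum>k<n. a k - a (Suc k))"
      by (rule order_trans[OF sum_abs]) (intro sum_mono slice)
    \<comment> \<open>The errors telescope to at most 1 whatever \<open>n\<close> is, while the
      left-hand side carries the factor \<open>n\<close>.\<close>
    also have "\<dots> = a 0 - a n" by (rule sum_lessThan_telescope')
    also have "\<dots> \<le> 1"
    proof -
      have "a 0 \<le> 1" "0 \<le> a n" by (simp_all add: a_def)
      then show ?thesis by linarith
    qed
    finally show ?thesis .
  qed
  show ?thesis
  proof (rule ccontr)
    assume ne: "L h \<noteq> (\<integral>z. h z \<partial>representing)"
    then obtain n :: nat where n: "1 < real n * \<bar>L h - (\<integral>z. h z \<partial>representing)\<bar>"
      using reals_Archimedean3[of "\<bar>L h - (\<integral>z. h z \<partial>representing)\<bar>"] by auto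
    then have "0 < n" by (cases n) auto
    then show False using approx[of n] n by linarith
  qed
qed

text \<open>The truncations \<open>F n\<close> scale into the unit interval. Monotone convergence
  handles their integrals, and the continuity of \<open>L\<close>, applied to the decreasing
  functions f - F n, handles the values of \<open>L\<close>.\<close>

lemma representing_nonneg:
  assumes f: "f \<in> V" "\<And>z. 0 \<le> f z"
  shows "integrable representing f \<and> (\<integral>z. f z \<partial>representing) = L f"
proof -
  define F where "F n = (\<lambda>z. min (f z) (real (Suc n)))" for n
  have F: "F n \<in> V" for n unfolding F_def using f by (intro min_mem const_mem)
  have F0: "0 \<le> F n z" for n z using f by (simp add: F_def)
  have int: "integrable representing (F n)" for n
    using F0 F borel_measurable_representing
    by (intro integrable_const_bound[of _ "real (Suc n)"]) (auto simp: F_def)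
  have eq: "(\<integral>z. F n z \<partial>representing) = L (F n)" for n
  proof -
    have "L (\<lambda>z. 1 / real (Suc n) * F n z) = (\<integral>z. 1 / real (Suc n) * F n z \<partial>representing)"
      using F F0 by (intro representing_unit scale_mem) (auto simp: F_def field_simps)
    then show ?thesis using F[of n] by (simp add: scale[of _ "1 / real (Suc n)", simplified])
  qed
  have lim: "(\<lambda>n. F n z) \<longlonglongrightarrow> f z" for z
  proof -
    obtain N :: nat where "f z \<le> real N" using real_arch_simple by blast
    then have "\<forall>n\<ge>N. F n z = f z" by (auto simp: F_def)
    then show ?thesis by (intro tendsto_eventually) (auto simp: eventually_sequentially)
  qed
  have "(\<lambda>n. L (\<lambda>z. f z - F n z)) \<longlonglongrightarrow> 0"
  proof (rule tendsto_zero)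
    show "(\<lambda>n. f z - F n z) \<longlonglongrightarrow> 0" for z
      using tendsto_diff[OF tendsto_const[of "f z"] lim[of z]] by simp
  qed (use f F in \<open>auto simp: F_def intro: diff_mem\<close>)
  then have "(\<lambda>n. L f - L (F n)) \<longlonglongrightarrow> 0" using f F by (simp add: diff)
  then have conv: "(\<lambda>n. \<integral>z. F n z \<partial>representing) \<longlonglongrightarrow> L f"
    using tendsto_diff[OF tendsto_const[of "L f"]] unfolding eq by fastforce
  have mono: "AE z in representing. mono (\<lambda>n. F n z)"
    by (auto simp: F_def mono_def)
  show ?thesis
    using integrable_monotone_convergence[OF int mono _ conv borel_measurable_representing[OF f(1)]]
      integral_monotone_convergence[OF int mono _ conv borel_measurable_representing[OF f(1)]] lim by simp
qed

theorem Daniell_representation: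
  assumes f: "f \<in> V"
  shows "integrable representing f" "(\<integral>z. f z \<partial>representing) = L f"
proof -
  let ?p = "\<lambda>z. max (f z) 0" and ?m = "\<lambda>z. max (- f z) 0"
  have V: "?p \<in> V" "?m \<in> V" using f by (auto intro: max_mem zero_mem uminus_mem)
  have split: "f = (\<lambda>z. ?p z - ?m z)" by auto
  have p: "integrable representing ?p \<and> (\<integral>z. ?p z \<partial>representing) = L ?p"
    and m: "integrable representing ?m \<and> (\<integral>z. ?m z \<partial>representing) = L ?m"
    using representing_nonneg[OF V(1)] representing_nonneg[OF V(2)] by simp_all
  have "integrable representing (\<lambda>z. ?p z - ?m z)" using p m by simp
  then show "integrable representing f" by (simp only: split[symmetric])
  have "L (\<lambda>z. ?p z - ?m z) = (\<integral>z. ?p z - ?m z \<partial>representing)" using p m V by (simp add: diff)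
  then show "(\<integral>z. f z \<partial>representing) = L f" by (simp only: split[symmetric])
qed

end

subsection \<open>Random continuous functions\<close>

text \<open>The union of finite 1/(n+1)-nets. It reduces suprema over a fibre to countable
  ones.\<close>

lemma compact_UNIV_countable_dense:
  assumes "compact (UNIV :: 'x :: metric_space set)"
  obtains D :: "'x :: metric_space set" where "countable D" "D \<noteq> {}" "closure D = UNIV"
proof -
  have "\<forall>e>0. \<exists>K. finite K \<and> (UNIV :: 'x set) \<subseteq> (\<Union>x\<in>K. ball x e)"
    using seq_compact_imp_totally_bounded[OF compact_imp_seq_compact[OF assms]] by blast
  then have "\<forall>n. \<exists>K. finite K \<and> (UNIV :: 'x set) \<subseteq> (\<Union>x\<in>K. ball x (1 / real (Suc n)))"
    by simp
  then obtain K where K: "\<And>n. finite (K n)" "\<And>n. (UNIV :: 'x set) \<subseteq> (\<Union>x\<in>K n. ball x (1 / real (Suc n)))"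
    by metis
  define D where "D = (\<Union>n. K n)"
  have "y \<in> closure D" for y
    unfolding closure_approachable
  proof (intro allI impI)
    fix e :: real assume "0 < e"
    then obtain n where n: "1 / real (Suc n) < e"
      using reals_Archimedean[of e] by (auto simp: inverse_eq_divide)
    obtain x where "x \<in> K n" "dist x y < 1 / real (Suc n)" using K(2)[of n] by fastforce
    then show "\<exists>x\<in>D. dist x y < e" using n unfolding D_def by (intro bexI[of _ x]) auto
  qed
  then have "closure D = UNIV" by blast
  moreover from this have "D \<noteq> {}" by auto
  moreover have "countable D" unfolding D_def using K(1) by (auto intro: countable_finite)
  ultimately show thesis using that by blast
qed

lemma distr_eq_measure_preserving_map:
  assumes "measure_preserving_map M \<phi>"
  shows "distr M M \<phi> = M"
  using assms by (intro measure_eqI) (auto simp: measure_preserving_map_def emeasure_distr)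

lemma measure_preserving_map_distr:
  assumes "\<phi> \<in> measurable M M" "distr M M \<phi> = M"
  shows "measure_preserving_map M \<phi>"
  unfolding measure_preserving_map_def
proof (intro conjI ballI)
  fix A assume "A \<in> sets M"
  then show "emeasure M (\<phi> -` A \<inter> space M) = emeasure M A"
    using emeasure_distr[OF assms(1), of A] assms(2) by simp
qed fact

section \<open>The fibrewise supremum norm\<close>

definition fibre_norm :: "('w \<times> 'x \<Rightarrow> real) \<Rightarrow> 'w \<Rightarrow> real" where
  "fibre_norm f \<omega> = (SUP x. \<bar>f (\<omega>, x)\<bar>)"

lemma L1C_norm_fibre_norm: "L1C_norm P f = (\<integral>\<omega>. fibre_norm f \<omega> \<partial>P)"
  by (simp add: L1C_norm_def fibre_norm_def)

lemma L1C_D: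
  assumes "f \<in> L1C P"
  shows "f \<in> borel_measurable (P \<Otimes>\<^sub>M borel)"
    and "\<omega> \<in> space P \<Longrightarrow> continuous_on UNIV (\<lambda>x. f (\<omega>, x))"
    and "integrable P (fibre_norm f)"
  using assms by (auto simp: L1C_def fibre_norm_def[abs_def])

context
  assumes compact: "compact (UNIV :: 'x :: metric_space set)"
begin

text \<open>Compactness bounds the fibre, so that the real-valued \<open>SUP\<close> is a genuine
  upper bound.\<close>

lemma abs_le_fibre_norm:
  fixes f :: "'w \<times> 'x \<Rightarrow> real"
  assumes "continuous_on UNIV (\<lambda>x. f (\<omega>, x))"
  shows "\<bar>f (\<omega>, x)\<bar> \<le> fibre_norm f \<omega>"
proof -
  have "compact (range (\<lambda>x. \<bar>f (\<omega>, x)\<bar>))"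
    using assms compact by (intro compact_continuous_image continuous_intros)
  then have "bdd_above (range (\<lambda>x. \<bar>f (\<omega>, x)\<bar>))"
    by (intro bounded_imp_bdd_above compact_imp_bounded)
  then show ?thesis unfolding fibre_norm_def by (intro cSUP_upper) auto
qed

lemma fibre_norm_le: "(\<And>x. \<bar>f (\<omega>, x)\<bar> \<le> c) \<Longrightarrow> fibre_norm f \<omega> \<le> c"
  unfolding fibre_norm_def by (intro cSUP_least) auto

lemma L1C_abs_le:
  fixes f :: "'w \<times> 'x \<Rightarrow> real"
  shows "f \<in> L1C P \<Longrightarrow> \<omega> \<in> space P \<Longrightarrow> \<bar>f (\<omega>, x)\<bar> \<le> fibre_norm f \<omega>"
  by (intro abs_le_fibre_norm L1C_D(2))

text \<open>By continuity the supremum may be taken over a countable dense set of points, and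
  countable suprema preserve measurability.\<close>

lemma borel_measurable_fibre_norm:
  fixes f :: "'w \<times> 'x \<Rightarrow> real"
  assumes f: "f \<in> borel_measurable (P \<Otimes>\<^sub>M borel)"
    and cont: "\<And>\<omega>. \<omega> \<in> space P \<Longrightarrow> continuous_on UNIV (\<lambda>x. f (\<omega>, x))"
  shows "fibre_norm f \<in> borel_measurable P"
proof -
  obtain D :: "'x set" where D: "countable D" "D \<noteq> {}" "closure D = UNIV"
    using compact_UNIV_countable_dense[OF compact] .
  have bdd: "bdd_above ((\<lambda>x. \<bar>f (\<omega>, x)\<bar>) ` D)" if "\<omega> \<in> space P" for \<omega>
    using abs_le_fibre_norm[OF cont[OF that]] by (intro bdd_aboveI2)
  have "fibre_norm f \<omega> = (SUP x\<in>D. \<bar>f (\<omega>, x)\<bar>)" if \<omega>: "\<omega> \<in> space P" for \<omega>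
  proof (rule antisym)
    have "closure D \<subseteq> {x. \<bar>f (\<omega>, x)\<bar> \<le> (SUP x\<in>D. \<bar>f (\<omega>, x)\<bar>)}"
    proof (rule closure_minimal)
      show "D \<subseteq> {x. \<bar>f (\<omega>, x)\<bar> \<le> (SUP x\<in>D. \<bar>f (\<omega>, x)\<bar>)}"
        using bdd[OF \<omega>] by (auto intro: cSUP_upper)
      show "closed {x. \<bar>f (\<omega>, x)\<bar> \<le> (SUP x\<in>D. \<bar>f (\<omega>, x)\<bar>)}"
        using cont[OF \<omega>] by (intro closed_Collect_le continuous_intros)
    qed
    then show "fibre_norm f \<omega> \<le> (SUP x\<in>D. \<bar>f (\<omega>, x)\<bar>)"
      using D(3) by (intro fibre_norm_le) auto
    show "(SUP x\<in>D. \<bar>f (\<omega>, x)\<bar>) \<le> fibre_norm f \<omega>"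
      using D(2) abs_le_fibre_norm[OF cont[OF \<omega>]] by (intro cSUP_least)
  qed
  moreover have "(\<lambda>\<omega>. f (\<omega>, x)) \<in> borel_measurable P" for x
    using measurable_compose[OF measurable_Pair2'[of x borel P] f] by simp
  then have "(\<lambda>\<omega>. SUP x\<in>D. \<bar>f (\<omega>, x)\<bar>) \<in> borel_measurable P"
    using D(1) bdd by (intro borel_measurable_cSUP borel_measurable_abs)
  ultimately show ?thesis by (simp cong: measurable_cong)
qed

text \<open>An integrable fibrewise majorant is enough, since the fibre norm is automatically
  measurable.\<close>

lemma L1C_I:
  fixes f :: "'w \<times> 'x \<Rightarrow> real"
  assumes f: "f \<in> borel_measurable (P \<Otimes>\<^sub>M borel)"
    and cont: "\<And>\<omega>. \<omega> \<in> space P \<Longrightarrow> continuous_on UNIV (\<lambda>x. f (\<omega>, x))"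
    and h: "integrable P h" "\<And>\<omega> x. \<omega> \<in> space P \<Longrightarrow> \<bar>f (\<omega>, x)\<bar> \<le> h \<omega>"
  shows "f \<in> L1C P" "L1C_norm P f \<le> (\<integral>\<omega>. h \<omega> \<partial>P)"
proof -
  have le: "fibre_norm f \<omega> \<le> h \<omega>" if "\<omega> \<in> space P" for \<omega>
    using h(2)[OF that] by (intro fibre_norm_le)
  have "0 \<le> fibre_norm f \<omega>" if "\<omega> \<in> space P" for \<omega>
    using abs_le_fibre_norm[of f \<omega> undefined, OF cont[OF that]] by simp
  then have int: "integrable P (fibre_norm f)"
    using le by (intro Bochner_Integration.integrable_bound[OF h(1)] borel_measurable_fibre_norm f cont AE_I2)
      (auto intro: order_trans[OF _ abs_ge_self])
  then show "f \<in> L1C P" using f cont by (simp add: L1C_def fibre_norm_def[abs_def])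
  show "L1C_norm P f \<le> (\<integral>\<omega>. h \<omega> \<partial>P)"
    unfolding L1C_norm_fibre_norm by (intro integral_mono int h(1) le)
qed

lemma fibre_norm_nonneg:
  fixes f :: "'w \<times> 'x \<Rightarrow> real"
  shows "f \<in> L1C P \<Longrightarrow> \<omega> \<in> space P \<Longrightarrow> 0 \<le> fibre_norm f \<omega>"
  using L1C_abs_le[of f P \<omega> undefined] by simp

lemma function_lattice_L1C:
  assumes "prob_space P"
  shows "function_lattice (L1C P :: ('w \<times> 'x \<Rightarrow> real) set)"
proof -
  interpret prob_space P by fact
  note meas = L1C_D(1)[measurable_dest]
  show ?thesis
  proof
    show "(\<lambda>_. 0) \<in> (L1C P :: ('w \<times> 'x \<Rightarrow> real) set)" by (rule L1C_I(1)[where h = "\<lambda>_. 0"]) auto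
    show "(\<lambda>_. 1) \<in> (L1C P :: ('w \<times> 'x \<Rightarrow> real) set)" by (rule L1C_I(1)[where h = "\<lambda>_. 1"]) auto
    fix f g :: "'w \<times> 'x \<Rightarrow> real" assume f: "f \<in> L1C P" and g: "g \<in> L1C P"
    show "(\<lambda>z. a * f z + b * g z) \<in> L1C P" for a b
    proof (rule L1C_I(1)[where h = "\<lambda>\<omega>. \<bar>a\<bar> * fibre_norm f \<omega> + \<bar>b\<bar> * fibre_norm g \<omega>"])
      fix \<omega> x assume "\<omega> \<in> space P"
      then have "\<bar>a * f (\<omega>, x)\<bar> \<le> \<bar>a\<bar> * fibre_norm f \<omega>" "\<bar>b * g (\<omega>, x)\<bar> \<le> \<bar>b\<bar> * fibre_norm g \<omega>"
        using L1C_abs_le[OF f] L1C_abs_le[OF g] by (simp_all add: abs_mult mult_left_mono)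
      then show "\<bar>a * f (\<omega>, x) + b * g (\<omega>, x)\<bar> \<le> \<bar>a\<bar> * fibre_norm f \<omega> + \<bar>b\<bar> * fibre_norm g \<omega>"
        by linarith
    qed (use L1C_D[OF f] L1C_D[OF g] in \<open>auto intro!: continuous_intros\<close>)
    show "(\<lambda>z. max (f z) (g z)) \<in> L1C P"
    proof (rule L1C_I(1)[where h = "\<lambda>\<omega>. fibre_norm f \<omega> + fibre_norm g \<omega>"])
      fix \<omega> x assume "\<omega> \<in> space P"
      then show "\<bar>max (f (\<omega>, x)) (g (\<omega>, x))\<bar> \<le> fibre_norm f \<omega> + fibre_norm g \<omega>"
        using L1C_abs_le[OF f, of \<omega> x] L1C_abs_le[OF g, of \<omega> x] by linarith
    qed (use L1C_D[OF f] L1C_D[OF g] in \<open>auto intro!: continuous_intros\<close>)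
  qed
qed

lemma fst_L1C:
  assumes "\<phi> \<in> borel_measurable P" "integrable P \<phi>"
  shows "(\<lambda>z. \<phi> (fst z)) \<in> (L1C P :: ('w \<times> 'x \<Rightarrow> real) set)"
    and "L1C_norm P (\<lambda>z :: 'w \<times> 'x. \<phi> (fst z)) \<le> (\<integral>\<omega>. \<bar>\<phi> \<omega>\<bar> \<partial>P)"
  using assms by (auto intro!: L1C_I[where h = "\<lambda>\<omega>. \<bar>\<phi> \<omega>\<bar>"])

lemma snd_L1C:
  fixes \<psi> :: "'x \<Rightarrow> real"
  assumes "prob_space P" "continuous_on UNIV \<psi>"
  shows "(\<lambda>z. \<psi> (snd z)) \<in> L1C P"
proof -
  interpret prob_space P by fact
  have "compact (range \<psi>)" using assms compact by (intro compact_continuous_image)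
  then obtain c where "\<And>x. \<bar>\<psi> x\<bar> \<le> c"
    using compact_imp_bounded[of "range \<psi>"] by (auto simp: bounded_iff)
  moreover have "\<psi> \<in> borel_measurable borel" using assms by (intro borel_measurable_continuous_onI)
  ultimately show ?thesis using assms by (intro L1C_I(1)[where h = "\<lambda>_. c"]) auto
qed

text \<open>Dini's theorem on each fibre, then dominated convergence.\<close>

lemma L1C_norm_decreasing_tendsto_0:
  fixes F :: "nat \<Rightarrow> 'w \<times> 'x \<Rightarrow> real"
  assumes F: "\<And>n. F n \<in> L1C P" and dec: "\<And>n z. F (Suc n) z \<le> F n z"
    and lim: "\<And>z. (\<lambda>n. F n z) \<longlonglongrightarrow> 0"
  shows "(\<lambda>n. L1C_norm P (F n)) \<longlonglongrightarrow> 0"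
proof -
  have decseq: "decseq (\<lambda>n. F n z)" for z using dec by (intro decseq_SucI)
  have nonneg: "0 \<le> F n z" for n z using decseq_ge[OF decseq lim] .
  have fibre: "(\<lambda>n. fibre_norm (F n) \<omega>) \<longlonglongrightarrow> 0" if \<omega>: "\<omega> \<in> space P" for \<omega>
  proof (rule LIMSEQ_I)
    fix r :: real assume r: "0 < r"
    \<comment> \<open>The margin r / 2 leaves room for the supremum, which inherits only a
      non-strict bound.\<close>
    define U where "U n = {x. F n (\<omega>, x) < r / 2}" for n
    have "open (U n)" for n
      unfolding U_def using L1C_D(2)[OF F \<omega>] by (intro open_Collect_less continuous_intros)
    moreover have "UNIV \<subseteq> (\<Union>n. U n)"
    proof
      fix x
      have "\<forall>\<^sub>F n in sequentially. F n (\<omega>, x) < r / 2" by (rule order_tendstoD(2)[OF lim]) (use r in simp)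
      then show "x \<in> (\<Union>n. U n)" by (auto simp: U_def eventually_sequentially)
    qed
    ultimately obtain I where "I \<subseteq> UNIV" and I: "finite I" "UNIV \<subseteq> (\<Union>n\<in>I. U n)"
      by (rule compactE_image[OF compact])
    have "norm (fibre_norm (F n) \<omega> - 0) < r" if n: "Max I \<le> n" for n
    proof -
      have "fibre_norm (F n) \<omega> \<le> r / 2"
      proof (rule fibre_norm_le)
        fix x
        obtain i where i: "i \<in> I" "x \<in> U i" using I by blast
        then have "i \<le> n" using I n by (meson Max_ge order_trans)
        then have "F n (\<omega>, x) \<le> F i (\<omega>, x)" using decseq by (auto simp: decseq_def)
        then show "\<bar>F n (\<omega>, x)\<bar> \<le> r / 2" using i nonneg[of n "(\<omega>, x)"] by (auto simp: U_def)
      qed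
      then show ?thesis using r fibre_norm_nonneg[OF F \<omega>, of n] by simp
    qed
    then show "\<exists>N. \<forall>n\<ge>N. norm (fibre_norm (F n) \<omega> - 0) < r" by blast
  qed
  have "(\<lambda>n. \<integral>\<omega>. fibre_norm (F n) \<omega> \<partial>P) \<longlonglongrightarrow> (\<integral>\<omega>. 0 \<partial>P)"
  proof (rule integral_dominated_convergence[where w = "fibre_norm (F 0)"])
    show "AE \<omega> in P. (\<lambda>n. fibre_norm (F n) \<omega>) \<longlonglongrightarrow> 0" using fibre by (intro AE_I2)
    show "AE \<omega> in P. norm (fibre_norm (F n) \<omega>) \<le> fibre_norm (F 0) \<omega>" for n
    proof (intro AE_I2)
      fix \<omega> assume \<omega>: "\<omega> \<in> space P"
      have "fibre_norm (F n) \<omega> \<le> fibre_norm (F 0) \<omega>"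
      proof (rule fibre_norm_le)
        fix x
        have "\<bar>F n (\<omega>, x)\<bar> \<le> \<bar>F 0 (\<omega>, x)\<bar>"
          using decseqD[OF decseq, of 0 n "(\<omega>, x)"] nonneg[of n "(\<omega>, x)"] by simp
        then show "\<bar>F n (\<omega>, x)\<bar> \<le> fibre_norm (F 0) \<omega>" using L1C_abs_le[OF F \<omega>] order_trans by blast
      qed
      then show "norm (fibre_norm (F n) \<omega>) \<le> fibre_norm (F 0) \<omega>"
        using fibre_norm_nonneg[OF F \<omega>, of n] by simp
    qed
  qed (use L1C_D(3)[OF F] in \<open>auto dest: borel_measurable_integrable\<close>)
  then show ?thesis by (simp add: L1C_norm_fibre_norm)
qed

text \<open>The marginal is \<open>P\<close>, so the fibre norm of \<open>f\<close>, read as a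
  function of the base coordinate, is an integrable majorant.\<close>

lemma integrable_prob_with_marginal:
  fixes f :: "'w \<times> 'x \<Rightarrow> real"
  assumes \<mu>: "\<mu> \<in> prob_with_marginal P" and f: "f \<in> L1C P"
  shows "integrable \<mu> f"
proof -
  have sets: "sets \<mu> = sets (P \<Otimes>\<^sub>M borel)" and dist: "distr \<mu> P fst = P"
    using \<mu> by (auto simp: prob_with_marginal_def)
  have sp: "space \<mu> = space P \<times> UNIV" using sets_eq_imp_space_eq[OF sets] by (simp add: space_pair_measure)
  have fst: "fst \<in> measurable \<mu> P" using sets by (simp cong: measurable_cong_sets)
  have "integrable (distr \<mu> P fst) (fibre_norm f)" unfolding dist by (rule L1C_D(3)[OF f])
  then have "integrable \<mu> (\<lambda>z. fibre_norm f (fst z))"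
    by (subst (asm) integrable_distr_eq[OF fst]) (use L1C_D(3)[OF f] in auto)
  then show ?thesis
  proof (rule Bochner_Integration.integrable_bound)
    show "f \<in> borel_measurable \<mu>" using L1C_D(1)[OF f] sets by (simp cong: measurable_cong_sets)
    show "AE z in \<mu>. norm (f z) \<le> norm (fibre_norm f (fst z))"
    proof (intro AE_I2)
      fix z assume "z \<in> space \<mu>"
      then show "norm (f z) \<le> norm (fibre_norm f (fst z))"
        using L1C_abs_le[OF f, of "fst z" "snd z"] sp by (auto intro: order_trans[OF _ abs_ge_self])
    qed
  qed
qed

text \<open>Functions of one coordinate suffice: indicators of measurable sets of \<omega> make
  \<open>fst\<close> measurable, and distance functions of x make \<open>snd\<close> measurable.
  Hence the measure from Daniell's theorem lives on the product \<sigma>-algebra.\<close>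

lemma sets_generated_L1C:
  assumes "prob_space P" "space P = UNIV"
  shows "sets (function_lattice.generated (L1C P :: ('w \<times> 'x \<Rightarrow> real) set)) = sets (P \<Otimes>\<^sub>M borel)"
proof -
  interpret prob_space P by fact
  interpret function_lattice "L1C P :: ('w \<times> 'x \<Rightarrow> real) set" by (rule function_lattice_L1C) fact
  have sp: "space (P \<Otimes>\<^sub>M (borel :: 'x measure)) = UNIV" using assms by (simp add: space_pair_measure)
  show ?thesis
  proof
    have "positivity_sets \<subseteq> sets (P \<Otimes>\<^sub>M (borel :: 'x measure))"
    proof
      fix X assume "X \<in> positivity_sets"
      then obtain f where f: "f \<in> L1C P" "X = {z \<in> space (P \<Otimes>\<^sub>M borel). 0 < f z}"
        unfolding sp by (auto simp: positivity_sets_def)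
      then show "X \<in> sets (P \<Otimes>\<^sub>M borel)" using L1C_D(1)[OF f(1)] by simp
    qed
    then show "sets generated \<subseteq> sets (P \<Otimes>\<^sub>M (borel :: 'x measure))"
      unfolding sets_generated sp[symmetric] by (rule sets.sigma_sets_subset)
    have "fst \<in> measurable generated P"
    proof (rule measurableI)
      fix A assume A: "A \<in> sets P"
      then have "(\<lambda>z. indicator A (fst z)) \<in> (L1C P :: ('w \<times> 'x \<Rightarrow> real) set)"
        by (intro fst_L1C integrable_real_indicator borel_measurable_indicator) (auto simp: emeasure_eq_measure)
      then show "fst -` A \<inter> space generated \<in> sets generated"
        using positive_set_in_generated by (fastforce simp: indicator_def vimage_def)
    qed (use assms in auto)
    moreover have "snd \<in> borel_measurable generated"
    proof (rule borel_measurableI)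
      fix S :: "'x set" assume S: "open S"
      show "snd -` S \<inter> space generated \<in> sets generated"
      \<comment> \<open>\<open>infdist\<close> to the empty set is 0 by convention, so the distance
        to the complement detects \<open>S\<close> only when the complement is nonempty.\<close>
      proof (cases "S = UNIV")
        case False
        have "(\<lambda>z. infdist (snd z) (- S)) \<in> (L1C P :: ('w \<times> 'x \<Rightarrow> real) set)"
          using assms by (intro snd_L1C continuous_on_infdist continuous_on_id)
        moreover have "x \<in> S \<longleftrightarrow> 0 < infdist x (- S)" for x
          using S False in_closed_iff_infdist_zero[of "- S" x] infdist_nonneg[of x "- S"] by (auto simp: less_le)
        ultimately show ?thesis
          using positive_set_in_generated by (fastforce simp: vimage_def)
      qed (use sets.top[of generated] in simp)
    qed
    ultimately have "(\<lambda>z. (fst z, snd z)) \<in> measurable generated (P \<Otimes>\<^sub>M (borel :: 'x measure))"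
      by (rule measurable_Pair)
    then show "sets (P \<Otimes>\<^sub>M (borel :: 'x measure)) \<subseteq> sets generated"
      unfolding prod.collapse by (auto dest!: measurable_sets)
  qed
qed

end

subsection \<open>Invariant functionals below a random pressure function\<close>

text \<open>A Folner sequence and injective left translations are common to the semigroup of
  nonnegative integer vectors and to amenable groups, so both are treated at once. With
  \<open>space P\<close> the whole type, identities for the skew product hold at every
  point.\<close>

locale invariant_pressure = random_dynamical_system P G act T
  for P :: "'w measure" and G :: "('g, 'b) monoid_scheme" (structure)
    and act :: "'g \<Rightarrow> 'w \<Rightarrow> 'w" and T :: "'g \<Rightarrow> 'w \<Rightarrow> 'x :: metric_space \<Rightarrow> 'x" +
  fixes \<Gamma> :: "('w \<times> 'x \<Rightarrow> real) \<Rightarrow> real" and F :: "nat \<Rightarrow> 'g set"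
  assumes space_P: "space P = UNIV"
    and pressure: "random_pressure_function P G act T \<Gamma>"
    and folner: "folner_sequence G F"
    and left_cancel: "h \<in> carrier G \<Longrightarrow> inj_on (\<lambda>g. h \<otimes> g) (carrier G)"
begin

sublocale function_lattice "L1C P :: ('w \<times> 'x \<Rightarrow> real) set"
  by (rule function_lattice_L1C[OF compact_fibre prob_space_axioms])

abbreviation \<Theta> :: "'g \<Rightarrow> 'w \<times> 'x \<Rightarrow> 'w \<times> 'x" where
  "\<Theta> \<equiv> skew_product act T"

lemma skew_product_mult:
  assumes "g \<in> carrier G" "h \<in> carrier G"
  shows "\<Theta> (g \<otimes> h) z = \<Theta> g (\<Theta> h z)"
  using act_mult[OF assms, of "fst z"] T_cocycle[OF assms, of "fst z"]
  by (simp add: skew_product_def split_beta space_P)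

lemma act_measurable: "g \<in> carrier G \<Longrightarrow> act g \<in> measurable P P"
  using act_preserving by (simp add: measure_preserving_map_def)

lemma skew_product_measurable:
  assumes "g \<in> carrier G"
  shows "\<Theta> g \<in> measurable (P \<Otimes>\<^sub>M borel) (P \<Otimes>\<^sub>M borel)"
proof -
  have "(\<lambda>z. (act g (fst z), (\<lambda>(\<omega>, x). T g \<omega> x) z)) \<in> measurable (P \<Otimes>\<^sub>M borel) (P \<Otimes>\<^sub>M borel)"
    using act_measurable[OF assms] T_measurable[OF assms] by (intro measurable_Pair) auto
  also have "(\<lambda>z. (act g (fst z), (\<lambda>(\<omega>, x). T g \<omega> x) z)) = \<Theta> g"
    by (auto simp: skew_product_def)
  finally show ?thesis .
qed

text \<open>Invariance of \<open>P\<close> ensures that each summand of an average costs no more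
  norm than \<open>f\<close> itself.\<close>

lemma fibre_norm_act:
  assumes f: "f \<in> (L1C P :: ('w \<times> 'x \<Rightarrow> real) set)" and g: "g \<in> carrier G"
  shows "integrable P (\<lambda>\<omega>. fibre_norm f (act g \<omega>))"
    and "(\<integral>\<omega>. fibre_norm f (act g \<omega>) \<partial>P) = L1C_norm P f"
proof -
  have dist: "distr P P (act g) = P"
    by (intro distr_eq_measure_preserving_map act_preserving g)
  have meas: "fibre_norm f \<in> borel_measurable P" using L1C_D(3)[OF f] by auto
  show "integrable P (\<lambda>\<omega>. fibre_norm f (act g \<omega>))"
    using integrable_distr_eq[OF act_measurable[OF g] meas] L1C_D(3)[OF f] dist by simp
  show "(\<integral>\<omega>. fibre_norm f (act g \<omega>) \<partial>P) = L1C_norm P f"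
    using integral_distr[OF act_measurable[OF g] meas] dist by (simp add: L1C_norm_fibre_norm)
qed

lemma abs_skew_product_le:
  assumes "f \<in> L1C P" "g \<in> carrier G"
  shows "\<bar>f (\<Theta> g (\<omega>, x))\<bar> \<le> fibre_norm f (act g \<omega>)"
  using L1C_abs_le[OF compact_fibre assms(1), of "act g \<omega>" "T g \<omega> x"]
  by (simp add: skew_product_def space_P)

lemma skew_product_L1C:
  assumes f: "f \<in> L1C P" and g: "g \<in> carrier G"
  shows "(\<lambda>z. f (\<Theta> g z)) \<in> L1C P"
proof (rule L1C_I(1)[OF compact_fibre, where h = "\<lambda>\<omega>. fibre_norm f (act g \<omega>)"])
  show "(\<lambda>z. f (\<Theta> g z)) \<in> borel_measurable (P \<Otimes>\<^sub>M borel)"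
    using measurable_compose[OF skew_product_measurable[OF g] L1C_D(1)[OF f]] .
  show "continuous_on UNIV (\<lambda>x. f (\<Theta> g (\<omega>, x)))" if "\<omega> \<in> space P" for \<omega>
    using continuous_on_compose2[OF L1C_D(2)[OF f, of "act g \<omega>"] T_continuous[OF g that]]
    by (simp add: skew_product_def space_P)
qed (use fibre_norm_act[OF f g] abs_skew_product_le[OF f g] in auto)

lemmas pressure_properties = pressure[unfolded random_pressure_function_def]

lemma pressure_mono:
  assumes "f \<in> L1C P" "g \<in> L1C P" "\<And>z. f z \<le> g z"
  shows "\<Gamma> f \<le> \<Gamma> g"
  by (rule pressure_properties[THEN conjunct1, rule_format, OF assms(1,2)]) (simp add: assms(3))

lemma pressure_add_const: "f \<in> L1C P \<Longrightarrow> \<Gamma> (\<lambda>z. f z + c) = \<Gamma> f + c"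
  by (rule pressure_properties[THEN conjunct2, THEN conjunct1, rule_format])

lemma pressure_convex:
  assumes "f \<in> L1C P" "g \<in> L1C P" "0 \<le> p" "p \<le> 1"
  shows "\<Gamma> (\<lambda>z. p * f z + (1 - p) * g z) \<le> p * \<Gamma> f + (1 - p) * \<Gamma> g"
  by (rule pressure_properties[THEN conjunct2, THEN conjunct2, THEN conjunct1, rule_format])
    (use assms in auto)

lemma pressure_lipschitz:
  "f \<in> L1C P \<Longrightarrow> g \<in> L1C P \<Longrightarrow> \<bar>\<Gamma> f - \<Gamma> g\<bar> \<le> L1C_norm P (\<lambda>z. f z - g z)"
  by (rule pressure_properties[THEN conjunct2, THEN conjunct2, THEN conjunct2, THEN conjunct1, rule_format])

lemma pressure_skew_product: "f \<in> L1C P \<Longrightarrow> g \<in> carrier G \<Longrightarrow> \<Gamma> (\<lambda>z. f (\<Theta> g z)) \<le> \<Gamma> f"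
  by (rule pressure_properties[THEN conjunct2, THEN conjunct2, THEN conjunct2, THEN conjunct2,
        rule_format, unfolded comp_def])

section \<open>Averages over finite sets and of coboundaries\<close>

definition average :: "'g set \<Rightarrow> ('w \<times> 'x \<Rightarrow> real) \<Rightarrow> 'w \<times> 'x \<Rightarrow> real" where
  "average A f = (\<lambda>z. (\<Sum>g\<in>A. f (\<Theta> g z)) / real (card A))"

lemma average_L1C:
  assumes "f \<in> L1C P" "A \<subseteq> carrier G"
  shows "average A f \<in> L1C P"
  using scale_mem[OF sum_mem[of A "\<lambda>g z. f (\<Theta> g z)"], of "1 / real (card A)"] skew_product_L1C assms
  by (auto simp: average_def subset_iff)

lemma average_lincomb:
  "average A (\<lambda>z. a * f z + b * g z) = (\<lambda>z. a * average A f z + b * average A g z)"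
  by (simp add: average_def sum.distrib sum_distrib_left add_divide_distrib)

text \<open>Induction on the set: a new point makes the average a convex combination of the old one
  and of \<open>f\<close> composed with a skew product, to which convexity and semi-cohomology
  apply.\<close>

lemma pressure_average_le:
  assumes f: "f \<in> L1C P" and A: "finite A" "A \<noteq> {}" "A \<subseteq> carrier G"
  shows "\<Gamma> (average A f) \<le> \<Gamma> f"
  using A
proof (induction A rule: finite_ne_induct)
  case (singleton g)
  then show ?case using pressure_skew_product[OF f] by (simp add: average_def)
next
  case (insert g A)
  define p where "p = real (card A) / real (card A + 1)"
  have p: "0 \<le> p" "p \<le> 1" by (auto simp: p_def)
  have cA: "0 < card A" using insert by (simp add: card_gt_0_iff)
  have avg: "average (insert g A) f = (\<lambda>z. p * average A f z + (1 - p) * f (\<Theta> g z))"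
  proof
    fix z
    have "1 - p = 1 / real (card A + 1)" by (simp add: p_def field_simps)
    moreover have "p * average A f z = (\<Sum>g\<in>A. f (\<Theta> g z)) / real (card A + 1)"
      using cA by (simp add: p_def average_def)
    ultimately show "average (insert g A) f z = p * average A f z + (1 - p) * f (\<Theta> g z)"
      using insert by (simp add: average_def add_divide_distrib add.commute)
  qed
  have "\<Gamma> (average (insert g A) f) \<le> p * \<Gamma> (average A f) + (1 - p) * \<Gamma> (\<lambda>z. f (\<Theta> g z))"
    unfolding avg using insert f p by (intro pressure_convex average_L1C skew_product_L1C) auto
  also have "\<dots> \<le> p * \<Gamma> f + (1 - p) * \<Gamma> f"
    using insert p by (intro add_mono mult_left_mono pressure_skew_product f) auto
  also have "\<dots> = \<Gamma> f" by (simp add: algebra_simps)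
  finally show ?case .
qed

text \<open>By the action law and the injectivity of left translation, composing with
  \<open>\<Theta> h\<close> turns the sum over \<open>A\<close> into the sum over
  \<open>h <# A\<close>. Only terms from the symmetric difference survive, each of norm at most
  \<open>L1C_norm P f\<close>.\<close>

lemma average_coboundary_norm:
  assumes f: "f \<in> L1C P" and h: "h \<in> carrier G" and A: "finite A" "A \<subseteq> carrier G"
  shows "L1C_norm P (average A (\<lambda>z. f (\<Theta> h z) - f z))
    \<le> real (card (sym_diff (h <# A) A)) / real (card A) * L1C_norm P f"
proof -
  let ?B = "h <# A"
  have B: "?B = (\<lambda>g. h \<otimes> g) ` A" by (auto simp: l_coset_def)
  have Bc: "?B \<subseteq> carrier G" and fB: "finite ?B" using A h by (auto simp: B)
  have inj: "inj_on (\<lambda>g. h \<otimes> g) A" by (rule inj_on_subset[OF left_cancel[OF h] A(2)])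
  let ?S = "sym_diff ?B A"
  have S: "finite ?S" "?S \<subseteq> carrier G" using fB A Bc by auto
  have avg: "average A (\<lambda>z. f (\<Theta> h z) - f z) z
      = ((\<Sum>g\<in>?B - A. f (\<Theta> g z)) - (\<Sum>g\<in>A - ?B. f (\<Theta> g z))) / real (card A)" for z
  proof -
    have "(\<Sum>g\<in>A. f (\<Theta> h (\<Theta> g z))) = (\<Sum>g\<in>A. f (\<Theta> (h \<otimes> g) z))"
      using h A by (intro sum.cong refl) (auto simp: skew_product_mult subset_iff)
    also have "\<dots> = (\<Sum>g\<in>?B. f (\<Theta> g z))" unfolding B by (simp add: sum.reindex[OF inj])
    also have "\<dots> = (\<Sum>g\<in>?B \<inter> A. f (\<Theta> g z)) + (\<Sum>g\<in>?B - A. f (\<Theta> g z))"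
      using fB by (rule sum.Int_Diff)
    finally have "(\<Sum>g\<in>A. f (\<Theta> h (\<Theta> g z))) = (\<Sum>g\<in>?B \<inter> A. f (\<Theta> g z)) + (\<Sum>g\<in>?B - A. f (\<Theta> g z))" .
    moreover have "(\<Sum>g\<in>A. f (\<Theta> g z)) = (\<Sum>g\<in>?B \<inter> A. f (\<Theta> g z)) + (\<Sum>g\<in>A - ?B. f (\<Theta> g z))"
      using sum.Int_Diff[OF A(1), of "\<lambda>g. f (\<Theta> g z)" ?B] by (simp add: Int_commute)
    ultimately show ?thesis by (simp add: average_def sum_subtractf)
  qed
  have bound: "\<bar>average A (\<lambda>z. f (\<Theta> h z) - f z) (\<omega>, x)\<bar> \<le> (\<Sum>g\<in>?S. fibre_norm f (act g \<omega>)) / real (card A)"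
    for \<omega> x
  proof -
    let ?f = "\<lambda>g. f (\<Theta> g (\<omega>, x))"
    have "\<bar>sum ?f (?B - A) - sum ?f (A - ?B)\<bar> \<le> (\<Sum>g\<in>?B - A. \<bar>?f g\<bar>) + (\<Sum>g\<in>A - ?B. \<bar>?f g\<bar>)"
      using sum_abs[of ?f "?B - A"] sum_abs[of ?f "A - ?B"] by linarith
    also have "\<dots> = (\<Sum>g\<in>?S. \<bar>?f g\<bar>)"
      using fB A by (intro sum.union_disjoint[symmetric]) auto
    also have "\<dots> \<le> (\<Sum>g\<in>?S. fibre_norm f (act g \<omega>))"
      using S f by (intro sum_mono abs_skew_product_le) auto
    finally show ?thesis unfolding avg by (simp add: divide_right_mono)
  qed
  have int: "integrable P (\<lambda>\<omega>. (\<Sum>g\<in>?S. fibre_norm f (act g \<omega>)) / real (card A))"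
    using S by (intro integrable_divide Bochner_Integration.integrable_sum fibre_norm_act(1) f) auto
  have L: "average A (\<lambda>z. f (\<Theta> h z) - f z) \<in> L1C P"
    using f h A by (intro average_L1C diff_mem skew_product_L1C)
  have "L1C_norm P (average A (\<lambda>z. f (\<Theta> h z) - f z))
      \<le> (\<integral>\<omega>. (\<Sum>g\<in>?S. fibre_norm f (act g \<omega>)) / real (card A) \<partial>P)"
    using bound by (intro L1C_I(2)[OF compact_fibre L1C_D(1,2)[OF L] int])
  also have "\<dots> = (\<Sum>g\<in>?S. \<integral>\<omega>. fibre_norm f (act g \<omega>) \<partial>P) / real (card A)"
    using S fibre_norm_act(1)[OF f] by (subst Bochner_Integration.integral_sum[symmetric]) auto
  also have "(\<Sum>g\<in>?S. \<integral>\<omega>. fibre_norm f (act g \<omega>) \<partial>P) = real (card ?S) * L1C_norm P f"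
    using S fibre_norm_act(2)[OF f] by (subst sum.cong[OF refl, of _ _ "\<lambda>_. L1C_norm P f"]) auto
  finally show ?thesis by simp
qed

section \<open>The upper limit of the normalised pressure\<close>

definition excess :: "('w \<times> 'x \<Rightarrow> real) \<Rightarrow> real" where
  "excess f = \<Gamma> f - \<Gamma> (\<lambda>_. 0)"

lemma excess_le_norm: "f \<in> L1C P \<Longrightarrow> excess f \<le> L1C_norm P f"
  using pressure_lipschitz[OF _ zero_mem, of f] by (simp add: excess_def)

lemma convex_excess: "convex_functional excess"
  unfolding convex_functional_def
proof (intro ballI)
  fix f g :: "'w \<times> 'x \<Rightarrow> real" and p :: real
  assume "f \<in> L1C P" "g \<in> L1C P" "p \<in> {0..1}"
  then have "\<Gamma> (\<lambda>z. p * f z + (1 - p) * g z) \<le> p * \<Gamma> f + (1 - p) * \<Gamma> g"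
    by (intro pressure_convex) auto
  then show "excess (\<lambda>z. p * f z + (1 - p) * g z) \<le> p * excess f + (1 - p) * excess g"
    unfolding excess_def by (simp add: algebra_simps)
qed

lemma excess_zero: "excess (\<lambda>_. 0) = 0"
  by (simp add: excess_def)

text \<open>The eventual upper bounds of the averaged values. Their infimum is the upper limit, and
  it is a meaningful real number once the set is nonempty and bounded below.\<close>

definition limit_bounds :: "('w \<times> 'x \<Rightarrow> real) \<Rightarrow> real set" where
  "limit_bounds f = {c. \<forall>\<^sub>F n in sequentially. excess (average (F n) f) \<le> c}"

definition limit_excess :: "('w \<times> 'x \<Rightarrow> real) \<Rightarrow> real" where
  "limit_excess f = Inf (limit_bounds f)"

lemma F: "finite (F n)" "F n \<noteq> {}" "F n \<subseteq> carrier G"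
  using folner by (auto simp: folner_sequence_def)

lemma excess_in_limit_bounds: "f \<in> L1C P \<Longrightarrow> excess f \<in> limit_bounds f"
  using pressure_average_le[OF _ F] by (auto simp: limit_bounds_def excess_def)

text \<open>The average of - f is minus the average of f, so its \<open>excess\<close> is at most
  that of - f. Convexity converts this upper bound into a lower bound at the average of f.\<close>

lemma bdd_below_limit_bounds:
  assumes f: "f \<in> L1C P"
  shows "bdd_below (limit_bounds f)"
proof (rule bdd_belowI)
  fix c assume "c \<in> limit_bounds f"
  then obtain n where "excess (average (F n) f) \<le> c"
    by (auto simp: limit_bounds_def eventually_sequentially)
  moreover have "- excess (\<lambda>z. - average (F n) f z) \<le> excess (average (F n) f)"
    using convex_functional_uminus[OF convex_excess excess_zero average_L1C[OF f F(3)]] .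
  moreover have "excess (\<lambda>z. - average (F n) f z) \<le> excess (\<lambda>z. - f z)"
    using pressure_average_le[OF uminus_mem[OF f] F, of n] average_lincomb[of "F n" "- 1" f 0 f]
    by (simp add: excess_def)
  ultimately show "- excess (\<lambda>z. - f z) \<le> c" by linarith
qed

lemma limit_excess_le: "f \<in> L1C P \<Longrightarrow> c \<in> limit_bounds f \<Longrightarrow> limit_excess f \<le> c"
  unfolding limit_excess_def by (intro cInf_lower bdd_below_limit_bounds)

lemma convex_limit_excess: "convex_functional limit_excess"
  unfolding convex_functional_def
proof (intro ballI)
  fix f g :: "'w \<times> 'x \<Rightarrow> real" and p :: real
  assume f: "f \<in> L1C P" and g: "g \<in> L1C P" and p: "p \<in> {0..1}"
  show "limit_excess (\<lambda>z. p * f z + (1 - p) * g z) \<le> p * limit_excess f + (1 - p) * limit_excess g"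
    unfolding limit_excess_def
  proof (rule Inf_le_convex_combination)
    show "bdd_below (limit_bounds (\<lambda>z. p * f z + (1 - p) * g z))"
      using f g by (intro bdd_below_limit_bounds lincomb_mem)
    fix c d assume "c \<in> limit_bounds f" "d \<in> limit_bounds g"
    then have "\<forall>\<^sub>F n in sequentially. excess (average (F n) f) \<le> c \<and> excess (average (F n) g) \<le> d"
      by (auto simp: limit_bounds_def intro: eventually_conj)
    then have "\<forall>\<^sub>F n in sequentially.
        excess (average (F n) (\<lambda>z. p * f z + (1 - p) * g z)) \<le> p * c + (1 - p) * d"
    proof eventually_elim
      case (elim n)
      have "excess (average (F n) (\<lambda>z. p * f z + (1 - p) * g z))
          \<le> p * excess (average (F n) f) + (1 - p) * excess (average (F n) g)"
        unfolding average_lincomb using p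
        by (intro convex_functionalD[OF convex_excess] average_L1C f g F(3)) auto
      also have "\<dots> \<le> p * c + (1 - p) * d"
        using elim p by (intro add_mono mult_left_mono) auto
      finally show ?case .
    qed
    then show "\<exists>e\<in>limit_bounds (\<lambda>z. p * f z + (1 - p) * g z). e \<le> p * c + (1 - p) * d"
      by (auto simp: limit_bounds_def)
  qed (use p excess_in_limit_bounds f g in blast)+
qed

lemma limit_excess_zero: "limit_excess (\<lambda>_. 0) = 0"
proof -
  have "limit_bounds (\<lambda>_. 0) = {0..}"
    by (auto simp: limit_bounds_def average_def excess_zero eventually_sequentially)
  then show ?thesis by (simp add: limit_excess_def)
qed

lemma limit_excess_coboundary:
  assumes f: "f \<in> L1C P" and h: "h \<in> carrier G"
  shows "limit_excess (\<lambda>z. f (\<Theta> h z) - f z) \<le> 0"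
proof (rule field_le_epsilon)
  fix e :: real assume e: "0 < e"
  have D: "(\<lambda>z. f (\<Theta> h z) - f z) \<in> L1C P" using f h by (intro diff_mem skew_product_L1C)
  have "(\<lambda>n. real (card (sym_diff (h <# F n) (F n))) / real (card (F n)) * L1C_norm P f) \<longlonglongrightarrow> 0 * L1C_norm P f"
    using folner h by (intro tendsto_intros) (auto simp: folner_sequence_def)
  then have "\<forall>\<^sub>F n in sequentially. real (card (sym_diff (h <# F n) (F n))) / real (card (F n)) * L1C_norm P f < e"
    by (rule order_tendstoD(2)) (use e in simp)
  then have "\<forall>\<^sub>F n in sequentially. excess (average (F n) (\<lambda>z. f (\<Theta> h z) - f z)) \<le> e"
  proof eventually_elim
    case (elim n)
    show ?case
      using excess_le_norm[OF average_L1C[OF D F(3)], of n] average_coboundary_norm[OF f h F(1,3), of n] elim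
      by linarith
  qed
  then show "limit_excess (\<lambda>z. f (\<Theta> h z) - f z) \<le> 0 + e"
    using limit_excess_le[OF D] by (simp add: limit_bounds_def)
qed

text \<open>Nonpositivity on coboundaries gives one inequality for \<open>f\<close>; the same for -
  f gives the other, without an inverse of \<open>\<Theta> h\<close>.\<close>

lemma invariant_linear_functional:
  obtains L where "linear_functional L" "\<And>f. f \<in> L1C P \<Longrightarrow> L f \<le> excess f"
    "\<And>f h. f \<in> L1C P \<Longrightarrow> h \<in> carrier G \<Longrightarrow> L (\<lambda>z. f (\<Theta> h z)) = L f"
proof -
  obtain L where L: "linear_functional L" and le: "\<And>f. f \<in> L1C P \<Longrightarrow> L f \<le> limit_excess f"
    by (rule Hahn_Banach_convex[OF convex_limit_excess limit_excess_zero]) blast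
  have diff: "L (\<lambda>z. f z - g z) = L f - L g" if "f \<in> L1C P" "g \<in> L1C P" for f g
  proof -
    have "L (\<lambda>z. 1 * f z + (- 1) * g z) = 1 * L f + (- 1) * L g"
      using L that unfolding linear_functional_def by blast
    then show ?thesis by simp
  qed
  have le0: "L (\<lambda>z. f (\<Theta> h z)) \<le> L f" if "f \<in> L1C P" "h \<in> carrier G" for f h
    using le[OF diff_mem[OF skew_product_L1C[OF that] that(1)]] limit_excess_coboundary[OF that]
      diff[OF skew_product_L1C[OF that] that(1)] by simp
  have neg: "L (\<lambda>z. - f z) = - L f" if "f \<in> L1C P" for f
    using diff[OF zero_mem that] diff[OF zero_mem zero_mem] by simp
  show thesis
  proof
    fix f assume f: "f \<in> (L1C P :: ('w \<times> 'x \<Rightarrow> real) set)"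
    show "L f \<le> excess f"
      using le[OF f] limit_excess_le[OF f excess_in_limit_bounds[OF f]] by linarith
    fix h assume h: "h \<in> carrier G"
    show "L (\<lambda>z. f (\<Theta> h z)) = L f"
      using le0[OF f h] le0[OF uminus_mem[OF f] h] neg[OF f] neg[OF skew_product_L1C[OF f h]] by simp
  qed fact
qed

text \<open>Functions in \<open>L1C P\<close> generate the product \<sigma>-algebra, so equal
  integrals identify the image measure with \<mu>.\<close>

lemma skew_product_preserving:
  assumes \<mu>: "prob_space \<mu>" "sets \<mu> = sets (P \<Otimes>\<^sub>M borel)" and g: "g \<in> carrier G"
    and inv: "\<And>f. f \<in> L1C P \<Longrightarrow> (\<integral>z. f (\<Theta> g z) \<partial>\<mu>) = (\<integral>z. f z \<partial>\<mu>)"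
  shows "measure_preserving_map \<mu> (\<Theta> g)"
proof (rule measure_preserving_map_distr)
  show meas: "\<Theta> g \<in> measurable \<mu> \<mu>"
    using skew_product_measurable[OF g] \<mu>(2) by (simp cong: measurable_cong_sets)
  have gen: "sets generated = sets (P \<Otimes>\<^sub>M (borel :: 'x measure))"
    by (rule sets_generated_L1C[OF compact_fibre prob_space_axioms space_P])
  show "distr \<mu> \<mu> (\<Theta> g) = \<mu>"
  proof (rule measure_eqI_lattice)
    show "prob_space (distr \<mu> \<mu> (\<Theta> g))" by (rule prob_space.prob_space_distr[OF \<mu>(1) meas])
    fix f assume f: "f \<in> (L1C P :: ('w \<times> 'x \<Rightarrow> real) set)"
    have meas_f: "f \<in> borel_measurable \<mu>" using L1C_D(1)[OF f] \<mu>(2) by (simp cong: measurable_cong_sets)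
    show "(\<integral>z. f z \<partial>distr \<mu> \<mu> (\<Theta> g)) = (\<integral>z. f z \<partial>\<mu>)"
      by (rule trans[OF integral_distr[OF meas meas_f] inv[OF f]])
  qed (use \<mu> gen in auto)
qed

theorem exists_equilibrium:
  obtains \<mu> where "\<mu> \<in> invariant_measures P G act T"
    "\<And>f. f \<in> L1C P \<Longrightarrow> (\<integral>z. f z \<partial>\<mu>) \<le> \<Gamma> f - \<Gamma> (\<lambda>_. 0)"
proof -
  obtain L where L: "linear_functional L" and le: "\<And>f. f \<in> L1C P \<Longrightarrow> L f \<le> excess f"
    and inv: "\<And>f h. f \<in> L1C P \<Longrightarrow> h \<in> carrier G \<Longrightarrow> L (\<lambda>z. f (\<Theta> h z)) = L f"
    by (rule invariant_linear_functional) blast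
  have lin: "L (\<lambda>z. a * f z + b * g z) = a * L f + b * L g" if "f \<in> L1C P" "g \<in> L1C P" for f g a b
    using L that unfolding linear_functional_def by blast
  have neg: "L (\<lambda>z. - f z) = - L f" if "f \<in> L1C P" for f
    using lin[OF that that, of "- 1" 0] by simp
  have norm: "L f \<le> L1C_norm P f" if "f \<in> L1C P" for f
    using le[OF that] excess_le_norm[OF that] by linarith
  \<comment> \<open>The cases c = 1 and c = - 1 together fix the value of \<open>L\<close> at the
    constant 1.\<close>
  have const: "L (\<lambda>_. c) \<le> c" for c
    using le[OF const_mem, of c] pressure_add_const[OF zero_mem, of c] by (simp add: excess_def)
  have pos: "0 \<le> L f" if "f \<in> L1C P" "\<And>z. 0 \<le> f z" for f
  proof -
    have "excess (\<lambda>z. - f z) \<le> 0"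
      unfolding excess_def using pressure_mono[OF uminus_mem[OF that(1)] zero_mem] that(2) by simp
    then show ?thesis using le[OF uminus_mem[OF that(1)]] neg[OF that(1)] by linarith
  qed
  interpret D: Daniell_functional "L1C P :: ('w \<times> 'x \<Rightarrow> real) set" L
  proof
    show "L (\<lambda>_. 1) = 1" using const[of 1] const[of "- 1"] neg[OF one_mem] by simp
    fix f :: "nat \<Rightarrow> 'w \<times> 'x \<Rightarrow> real"
    assume f: "\<And>n. f n \<in> L1C P" "\<And>n z. f (Suc n) z \<le> f n z" "\<And>z. (\<lambda>n. f n z) \<longlonglongrightarrow> 0"
    have "0 \<le> f n z" for n z
      using decseq_ge[OF decseq_SucI[of "\<lambda>n. f n z"] f(3)] f(2) by blast
    then have "0 \<le> L (f n)" for n using f(1) by (intro pos)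
    then show "(\<lambda>n. L (f n)) \<longlonglongrightarrow> 0"
      using norm[OF f(1)]
      by (intro tendsto_sandwich[OF _ _ tendsto_const L1C_norm_decreasing_tendsto_0[OF compact_fibre f]])
        (auto intro: always_eventually)
  qed (use L pos in auto)
  let ?\<mu> = D.representing
  have sets: "sets ?\<mu> = sets (P \<Otimes>\<^sub>M (borel :: 'x measure))"
    using sets_generated_L1C[OF compact_fibre prob_space_axioms space_P] by simp
  have fst: "fst \<in> measurable ?\<mu> P" using sets by (simp cong: measurable_cong_sets)
  have "distr ?\<mu> P fst = P"
  proof (rule measure_eqI)
    fix A assume "A \<in> sets (distr ?\<mu> P fst)"
    then have A: "A \<in> sets P" by simp
    define ind :: "'w set \<Rightarrow> 'w \<times> 'x \<Rightarrow> real" where "ind B = (\<lambda>z. indicator B (fst z))" for B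
    have ind: "ind B \<in> L1C P" "L (ind B) \<le> prob B" if "B \<in> sets P" for B
    proof -
      have i: "indicator B \<in> borel_measurable P" "integrable P (indicator B :: 'w \<Rightarrow> real)"
        using that by (auto simp: emeasure_eq_measure)
      show "ind B \<in> L1C P" unfolding ind_def by (rule fst_L1C(1)[OF compact_fibre i])
      then have "L (ind B) \<le> L1C_norm P (ind B)" by (rule norm)
      also have "\<dots> \<le> (\<integral>\<omega>. \<bar>indicator B \<omega>\<bar> \<partial>P)"
        unfolding ind_def by (rule fst_L1C(2)[OF compact_fibre i])
      finally show "L (ind B) \<le> prob B" using that by simp
    qed
    have cA: "space P - A \<in> sets P" using A by simp
    have "ind (space P - A) = (\<lambda>z. 1 * 1 + (- 1) * ind A z)"
      by (auto simp: ind_def indicator_def space_P)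
    then have "L (ind (space P - A)) = 1 - L (ind A)"
      using lin[OF one_mem ind(1)[OF A], of 1 "- 1"] D.one by simp
    \<comment> \<open>The upper bounds for \<open>A\<close> and for its complement add up to 1, and
      so do the values of \<open>L\<close>; neither bound can be strict.\<close>
    then have "L (ind A) = prob A" using ind(2)[OF A] ind(2)[OF cA] prob_compl[OF A] by simp
    moreover have "L (ind A) = measure ?\<mu> (fst -` A \<inter> space ?\<mu>)"
    proof -
      have "(\<integral>z. ind A z \<partial>?\<mu>) = (\<integral>z. indicator (fst -` A \<inter> space ?\<mu>) z \<partial>?\<mu>)"
        by (auto simp: ind_def indicator_def intro!: Bochner_Integration.integral_cong)
      then show ?thesis
        using D.Daniell_representation(2)[OF ind(1)[OF A]] measurable_sets[OF fst A] by simp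
    qed
    ultimately show "emeasure (distr ?\<mu> P fst) A = emeasure P A"
      using A fst by (simp add: emeasure_distr D.emeasure_eq_measure emeasure_eq_measure)
  qed simp
  then have "?\<mu> \<in> prob_with_marginal P"
    unfolding prob_with_marginal_def using sets D.prob_space_axioms by simp
  moreover have "measure_preserving_map ?\<mu> (\<Theta> g)" if g: "g \<in> carrier G" for g
  proof (rule skew_product_preserving[OF D.prob_space_axioms sets g])
    fix f assume f: "f \<in> (L1C P :: ('w \<times> 'x \<Rightarrow> real) set)"
    show "(\<integral>z. f (\<Theta> g z) \<partial>?\<mu>) = (\<integral>z. f z \<partial>?\<mu>)"
      unfolding D.Daniell_representation(2)[OF skew_product_L1C[OF f g]] D.Daniell_representation(2)[OF f]
      by (rule inv[OF f g])
  qed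
  ultimately have "?\<mu> \<in> invariant_measures P G act T" by (simp add: invariant_measures_def)
  moreover have "(\<integral>z. f z \<partial>?\<mu>) \<le> \<Gamma> f - \<Gamma> (\<lambda>_. 0)" if "f \<in> L1C P" for f
    using le[OF that] D.Daniell_representation(2)[OF that] by (simp add: excess_def)
  ultimately show thesis by (rule that)
qed

end

subsection \<open>Folner sequences\<close>

definition left_cancellative :: "('g, 'b) monoid_scheme \<Rightarrow> bool" where
  "left_cancellative G \<longleftrightarrow> (\<forall>h\<in>carrier G. inj_on (\<lambda>g. h \<otimes>\<^bsub>G\<^esub> g) (carrier G))"

lemma (in group) left_cancellative: "left_cancellative G"
  by (auto simp: left_cancellative_def inj_on_def)

lemma carrier_Zplus: "carrier (Zplus k) = {..<k} \<rightarrow>\<^sub>E {0..}"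
  by (simp add: Zplus_def)

lemma mult_Zplus: "x \<otimes>\<^bsub>Zplus k\<^esub> y = (\<lambda>j\<in>{..<k}. x j + y j)"
  by (simp add: Zplus_def)

lemma left_cancellative_Zplus: "left_cancellative (Zplus k)"
  unfolding left_cancellative_def
proof (intro ballI inj_onI)
  fix h x y assume x: "x \<in> carrier (Zplus k)" and y: "y \<in> carrier (Zplus k)"
    and eq: "h \<otimes>\<^bsub>Zplus k\<^esub> x = h \<otimes>\<^bsub>Zplus k\<^esub> y"
  show "x = y"
  proof (rule PiE_ext)
    fix j assume "j \<in> {..<k}"
    then show "x j = y j" using fun_cong[OF eq, of j] by (simp add: mult_Zplus)
  qed (use x y in \<open>auto simp: carrier_Zplus\<close>)
qed

text \<open>For a \<ge> 0 this is the proportion of {0..n} that a shift by \<open>a\<close> still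
  covers. The truncation by \<open>nat\<close> affects only finitely many n.\<close>

lemma tendsto_shifted_ratio: "(\<lambda>n. real (nat (int n + 1 - a)) / real (n + 1)) \<longlonglongrightarrow> 1"
proof -
  have "(\<lambda>n. 1 - real_of_int a * inverse (real (Suc n))) \<longlonglongrightarrow> 1 - real_of_int a * 0"
    by (intro tendsto_intros LIMSEQ_inverse_real_of_nat)
  moreover have "\<forall>\<^sub>F n in sequentially.
      1 - real_of_int a * inverse (real (Suc n)) = real (nat (int n + 1 - a)) / real (n + 1)"
    using eventually_ge_at_top[of "nat a"]
    by eventually_elim (simp add: field_simps)
  ultimately show ?thesis by (simp add: tendsto_cong)
qed

text \<open>A box and its translate have equally many points and meet in the box with sides {a
  j..n}, whose relative size is a product of \<open>k\<close> ratios tending to 1. The Folner ratio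
  is twice the deficit.\<close>

lemma folner_sequence_Zplus: "folner_sequence (Zplus k) (\<lambda>n. {..<k} \<rightarrow>\<^sub>E {0..int n})"
  unfolding folner_sequence_def
proof (intro conjI allI ballI)
  fix n
  show "{..<k} \<rightarrow>\<^sub>E {0..int n} \<subseteq> carrier (Zplus k)" unfolding carrier_Zplus by (rule PiE_mono) auto
  show "finite ({..<k} \<rightarrow>\<^sub>E {0..int n})" by (rule finite_PiE) auto
  show "{..<k} \<rightarrow>\<^sub>E {0..int n} \<noteq> {}" by (simp add: PiE_eq_empty_iff)
next
  fix a assume a: "a \<in> carrier (Zplus k)"
  define B where "B n = {..<k} \<rightarrow>\<^sub>E {0..int n}" for n
  let ?A = "\<lambda>n. a <#\<^bsub>Zplus k\<^esub> B n"
  have A: "?A n = (\<lambda>x. a \<otimes>\<^bsub>Zplus k\<^esub> x) ` B n" for n by (auto simp: l_coset_def)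
  have fB: "finite (B n)" for n unfolding B_def by (rule finite_PiE) auto
  have cB: "card (B n) = (n + 1) ^ k" for n
    by (simp add: B_def card_PiE nat_add_distrib)
  have "B n \<subseteq> carrier (Zplus k)" for n unfolding carrier_Zplus B_def by (rule PiE_mono) auto
  then have "inj_on (\<lambda>x. a \<otimes>\<^bsub>Zplus k\<^esub> x) (B n)" for n
    using left_cancellative_Zplus a inj_on_subset unfolding left_cancellative_def by blast
  then have cA: "card (?A n) = card (B n)" and fA: "finite (?A n)" for n
    using fB by (simp_all add: A card_image)
  \<comment> \<open>A point of the box is a translate exactly if subtracting \<open>a\<close> leaves
    nonnegative coordinates, a genuine condition in a semigroup.\<close>
  have "?A n \<inter> B n = ({..<k} \<rightarrow>\<^sub>E {0..int n}) \<inter> (\<Pi>\<^sub>E j\<in>{..<k}. {a j..int n})" for n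
  proof (intro equalityI subsetI)
    fix y assume y: "y \<in> ?A n \<inter> B n"
    then obtain x where x: "x \<in> B n" "y = a \<otimes>\<^bsub>Zplus k\<^esub> x" by (auto simp: A)
    have "y j \<in> {a j..int n}" if "j < k" for j
      using x y that by (auto simp: mult_Zplus B_def PiE_iff)
    then show "y \<in> ({..<k} \<rightarrow>\<^sub>E {0..int n}) \<inter> (\<Pi>\<^sub>E j\<in>{..<k}. {a j..int n})"
      using y by (auto simp: B_def PiE_iff)
  next
    fix y assume y: "y \<in> ({..<k} \<rightarrow>\<^sub>E {0..int n}) \<inter> (\<Pi>\<^sub>E j\<in>{..<k}. {a j..int n})"
    \<comment> \<open>The restriction to {..<k} keeps the witness extensional, as elements of the
      carrier must be.\<close>
    define x where "x = (\<lambda>j\<in>{..<k}. y j - a j)"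
    have "0 \<le> y j - a j \<and> y j - a j \<le> int n" if "j < k" for j
    proof -
      have "0 \<le> a j" "a j \<le> y j" "y j \<le> int n" using y a that by (auto simp: PiE_iff carrier_Zplus)
      then show ?thesis by linarith
    qed
    then have "x \<in> B n" by (auto simp: x_def B_def PiE_iff)
    moreover have "y = a \<otimes>\<^bsub>Zplus k\<^esub> x"
      using y by (auto simp: mult_Zplus x_def PiE_iff extensional_def fun_eq_iff)
    ultimately have "y \<in> ?A n" unfolding A by blast
    moreover have "y \<in> B n" using y unfolding B_def by (rule IntD1)
    ultimately show "y \<in> ?A n \<inter> B n" by (rule IntI)
  qed
  moreover have "(\<Pi>\<^sub>E j\<in>{..<k}. {a j..int n}) \<subseteq> {..<k} \<rightarrow>\<^sub>E {0..int n}" for n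
  proof (rule PiE_mono)
    fix j assume "j \<in> {..<k}"
    then have "0 \<le> a j" using a by (auto simp: carrier_Zplus PiE_iff)
    then show "{a j..int n} \<subseteq> {0..int n}" by simp
  qed
  ultimately have "?A n \<inter> B n = (\<Pi>\<^sub>E j\<in>{..<k}. {a j..int n})" for n by blast
  then have cAB: "card (?A n \<inter> B n) = (\<Prod>j<k. nat (int n + 1 - a j))" for n
    by (simp add: card_PiE diff_add_eq)
  have sym: "card (sym_diff (?A n) (B n)) = (card (?A n) - card (?A n \<inter> B n)) + (card (B n) - card (?A n \<inter> B n))" for n
  proof -
    have "card (sym_diff (?A n) (B n)) = card (?A n - B n) + card (B n - ?A n)"
      using fA fB by (intro card_Un_disjoint) auto
    then show ?thesis using fA[of n] fB[of n]
      by (simp add: card_Diff_subset_Int Int_commute)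
  qed
  have "real (card (sym_diff (?A n) (B n))) / real (card (B n))
      = 2 * (1 - (\<Prod>j<k. real (nat (int n + 1 - a j)) / real (n + 1)))" for n
  proof -
    define c where "c = (\<Prod>j<k. nat (int n + 1 - a j))"
    \<comment> \<open>This turns the truncated subtraction of naturals into a subtraction of
      reals.\<close>
    have "c \<le> card (B n)" unfolding c_def cAB[symmetric] using fB by (intro card_mono) auto
    then have "real (card (sym_diff (?A n) (B n))) = 2 * (real (card (B n)) - real c)"
      unfolding sym cA cAB c_def[symmetric] by (simp add: of_nat_diff)
    moreover have "(\<Prod>j<k. real (nat (int n + 1 - a j)) / real (n + 1)) = real c / real (card (B n))"
      unfolding c_def cB by (simp add: prod_dividef)
    moreover have "real (card (B n)) \<noteq> 0" unfolding cB by simp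
    ultimately show ?thesis by (simp add: diff_divide_distrib right_diff_distrib)
  qed
  moreover have "(\<lambda>n. 2 * (1 - (\<Prod>j<k. real (nat (int n + 1 - a j)) / real (n + 1)))) \<longlonglongrightarrow> 2 * (1 - (\<Prod>j<k. 1))"
    by (intro tendsto_intros tendsto_shifted_ratio)
  ultimately show "(\<lambda>n. real (card (sym_diff (a <#\<^bsub>Zplus k\<^esub> ({..<k} \<rightarrow>\<^sub>E {0..int n})) ({..<k} \<rightarrow>\<^sub>E {0..int n})))
      / real (card ({..<k} \<rightarrow>\<^sub>E {0..int n}))) \<longlonglongrightarrow> 0"
    unfolding B_def by simp
qed

text \<open>The isomorphism carries the translate of a preimage onto the translate of
  \<open>F n\<close> by \<open>\<phi> g\<close>. Injectivity makes images commute with set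
  difference, so all cardinalities agree.\<close>

lemma folner_sequence_iso:
  assumes "monoid G" and \<phi>: "\<phi> \<in> iso G H" and F: "folner_sequence H F"
  shows "folner_sequence G (\<lambda>n. {x \<in> carrier G. \<phi> x \<in> F n})"
proof -
  interpret monoid G by fact
  define B where "B n = {x \<in> carrier G. \<phi> x \<in> F n}" for n
  have inj: "inj_on \<phi> (carrier G)" and surj: "\<phi> ` carrier G = carrier H"
    and hom: "\<And>x y. x \<in> carrier G \<Longrightarrow> y \<in> carrier G \<Longrightarrow> \<phi> (x \<otimes>\<^bsub>G\<^esub> y) = \<phi> x \<otimes>\<^bsub>H\<^esub> \<phi> y"
    using \<phi> by (auto simp: iso_def bij_betw_def hom_def)
  have Bc: "B n \<subseteq> carrier G" for n by (auto simp: B_def)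
  have im: "\<phi> ` B n = F n" for n
  proof -
    have "F n \<subseteq> \<phi> ` carrier G" using F surj by (simp add: folner_sequence_def)
    then show ?thesis by (auto simp: B_def)
  qed
  have card_im: "card (\<phi> ` S) = card S" if "S \<subseteq> carrier G" for S
    using inj_on_subset[OF inj that] by (rule card_image)
  have "finite (B n)" "B n \<noteq> {}" for n
    using F im[of n] inj_on_subset[OF inj Bc] finite_image_iff unfolding folner_sequence_def by fastforce+
  moreover have "real (card (sym_diff (g <#\<^bsub>G\<^esub> B n) (B n))) / real (card (B n))
      = real (card (sym_diff (\<phi> g <#\<^bsub>H\<^esub> F n) (F n))) / real (card (F n))" if g: "g \<in> carrier G" for g n
  proof -
    have gB: "g <#\<^bsub>G\<^esub> B n \<subseteq> carrier G" using g Bc by (auto simp: l_coset_def)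
    have "\<phi> ` (g <#\<^bsub>G\<^esub> B n) = \<phi> g <#\<^bsub>H\<^esub> (\<phi> ` B n)"
    proof -
      have "\<phi> ` (g <#\<^bsub>G\<^esub> B n) = (\<lambda>x. \<phi> (g \<otimes>\<^bsub>G\<^esub> x)) ` B n" by (auto simp: l_coset_def)
      also have "\<dots> = (\<lambda>x. \<phi> g \<otimes>\<^bsub>H\<^esub> \<phi> x) ` B n"
        using Bc[of n] by (intro image_cong refl hom g) auto
      finally show ?thesis by (auto simp: l_coset_def)
    qed
    moreover have "\<phi> ` ((g <#\<^bsub>G\<^esub> B n) - B n) = \<phi> ` (g <#\<^bsub>G\<^esub> B n) - \<phi> ` B n"
      "\<phi> ` (B n - (g <#\<^bsub>G\<^esub> B n)) = \<phi> ` B n - \<phi> ` (g <#\<^bsub>G\<^esub> B n)"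
      using gB Bc[of n] by (intro inj_on_image_set_diff[OF inj]; blast)+
    ultimately have "\<phi> ` sym_diff (g <#\<^bsub>G\<^esub> B n) (B n) = sym_diff (\<phi> g <#\<^bsub>H\<^esub> F n) (F n)"
      unfolding image_Un im by simp
    then show ?thesis
      using card_im[of "sym_diff (g <#\<^bsub>G\<^esub> B n) (B n)"] card_im[OF Bc, of n] im[of n] gB Bc[of n] by force
  qed
  ultimately show ?thesis
    using F surj Bc unfolding B_def[symmetric] folner_sequence_def by auto
qed

lemma left_cancellative_iso:
  assumes \<phi>: "\<phi> \<in> iso G H" and H: "left_cancellative H"
  shows "left_cancellative G"
  unfolding left_cancellative_def
proof (intro ballI inj_onI)
  fix h x y assume h: "h \<in> carrier G" and x: "x \<in> carrier G" and y: "y \<in> carrier G"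
    and eq: "h \<otimes>\<^bsub>G\<^esub> x = h \<otimes>\<^bsub>G\<^esub> y"
  have inj: "inj_on \<phi> (carrier G)" and cl: "\<And>x. x \<in> carrier G \<Longrightarrow> \<phi> x \<in> carrier H"
    and hom: "\<And>x y. x \<in> carrier G \<Longrightarrow> y \<in> carrier G \<Longrightarrow> \<phi> (x \<otimes>\<^bsub>G\<^esub> y) = \<phi> x \<otimes>\<^bsub>H\<^esub> \<phi> y"
    using \<phi> by (auto simp: iso_def bij_betw_def hom_def)
  have "\<phi> h \<otimes>\<^bsub>H\<^esub> \<phi> x = \<phi> h \<otimes>\<^bsub>H\<^esub> \<phi> y" using arg_cong[OF eq, of \<phi>] hom h x y by simp
  then have "\<phi> x = \<phi> y" using H cl h x y unfolding left_cancellative_def inj_on_def by blast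
  then show "x = y" using inj x y by (auto dest: inj_onD)
qed

subsection \<open>Mixtures, semicontinuity and the variational principle\<close>

context
  fixes p :: real and \<mu> \<nu> :: "'a measure"
  assumes p: "p \<in> {0..1}" and sets_eq: "sets \<mu> = sets \<nu>"
begin

lemma sets_mixture [simp]: "sets (mixture p \<mu> \<nu>) = sets \<mu>"
  by (simp add: mixture_def)

lemma space_mixture [simp]: "space (mixture p \<mu> \<nu>) = space \<mu>"
  by (simp add: mixture_def)

text \<open>\<open>measure_of\<close> returns the prescribed set function only if that is a measure,
  so countable additivity has to be checked.\<close>

lemma emeasure_mixture:
  assumes "A \<in> sets \<mu>"
  shows "emeasure (mixture p \<mu> \<nu>) A = ennreal p * emeasure \<mu> A + ennreal (1 - p) * emeasure \<nu> A"
  unfolding mixture_def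
proof (rule emeasure_measure_of_sigma[OF sets.sigma_algebra_axioms _ _ assms])
  let ?m = "\<lambda>A. ennreal p * emeasure \<mu> A + ennreal (1 - p) * emeasure \<nu> A"
  show "positive (sets \<mu>) ?m" by (simp add: positive_def)
  show "countably_additive (sets \<mu>) ?m"
  proof (rule countably_additiveI)
    fix A :: "nat \<Rightarrow> 'a set" assume A: "range A \<subseteq> sets \<mu>" "disjoint_family A"
    have "(\<Sum>i. ?m (A i)) = ennreal p * (\<Sum>i. emeasure \<mu> (A i)) + ennreal (1 - p) * (\<Sum>i. emeasure \<nu> (A i))"
      by (subst suminf_add[symmetric]) auto
    then show "(\<Sum>i. ?m (A i)) = ?m (\<Union>i. A i)"
      using A sets_eq by (simp add: suminf_emeasure)
  qed
qed

lemma nn_integral_mixture: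
  assumes "f \<in> borel_measurable \<mu>"
  shows "(\<integral>\<^sup>+z. f z \<partial>mixture p \<mu> \<nu>)
    = ennreal p * (\<integral>\<^sup>+z. f z \<partial>\<mu>) + ennreal (1 - p) * (\<integral>\<^sup>+z. f z \<partial>\<nu>)"
proof -
  have m: "g \<in> borel_measurable (mixture p \<mu> \<nu>)" "g \<in> borel_measurable \<nu>"
    if "g \<in> borel_measurable \<mu>" for g :: "'a \<Rightarrow> ennreal"
    using that sets_eq by (simp_all cong: measurable_cong_sets)
  have sp: "space \<nu> = space \<mu>" using sets_eq_imp_space_eq[OF sets_eq] by simp
  from assms show ?thesis
  proof (induction f rule: borel_measurable_induct)
    case (cong f g)
    have "(\<integral>\<^sup>+z. f z \<partial>K) = (\<integral>\<^sup>+z. g z \<partial>K)" if "space K = space \<mu>" for K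
      using cong(3) that by (intro nn_integral_cong) auto
    then show ?case using cong(4) sp by simp
  next
    case (set A)
    then show ?case using sets_eq by (simp add: emeasure_mixture)
  next
    case (mult u c)
    have u: "u \<in> borel_measurable \<mu>" by fact
    show ?case
      unfolding nn_integral_cmult[OF u] nn_integral_cmult[OF m(1)[OF u]] nn_integral_cmult[OF m(2)[OF u]] mult.IH
      by (simp add: distrib_left mult.left_commute)
  next
    case (add u v)
    have u: "u \<in> borel_measurable \<mu>" and v: "v \<in> borel_measurable \<mu>" by fact+
    show ?case
      unfolding nn_integral_add[OF v u] nn_integral_add[OF m(1)[OF v] m(1)[OF u]]
        nn_integral_add[OF m(2)[OF v] m(2)[OF u]] add.IH
      by (simp add: distrib_left ac_simps)
  next
    case (seq U)
    have inc: "incseq U" and U: "\<And>i. U i \<in> borel_measurable \<mu>" by fact+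
    have sup: "(\<integral>\<^sup>+z. (SUP i. U i) z \<partial>K) = (SUP i. \<integral>\<^sup>+z. U i z \<partial>K)"
      if "\<And>i. U i \<in> borel_measurable K" for K
      unfolding SUP_apply by (rule nn_integral_monotone_convergence_SUP[OF inc that])
    \<comment> \<open>Suprema of sums split because both sequences increase.\<close>
    have incK: "incseq (\<lambda>i. c * (\<integral>\<^sup>+z. U i z \<partial>K))" for K and c :: ennreal
      using inc by (intro monoI mult_left_mono nn_integral_mono) (auto simp: incseq_def le_fun_def)
    show ?case
      unfolding sup[OF U] sup[OF m(1)[OF U]] sup[OF m(2)[OF U]] seq.IH
      by (simp only: SUP_mult_left_ennreal ennreal_SUP_add[OF incK incK])
  qed
qed

lemma integral_mixture:
  fixes f :: "'a \<Rightarrow> real"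
  assumes "integrable \<mu> f" "integrable \<nu> f" "integrable (mixture p \<mu> \<nu>) f"
  shows "(\<integral>z. f z \<partial>mixture p \<mu> \<nu>) = p * (\<integral>z. f z \<partial>\<mu>) + (1 - p) * (\<integral>z. f z \<partial>\<nu>)"
proof -
  have "enn2real (\<integral>\<^sup>+z. ennreal (g z) \<partial>mixture p \<mu> \<nu>)
      = p * enn2real (\<integral>\<^sup>+z. ennreal (g z) \<partial>\<mu>) + (1 - p) * enn2real (\<integral>\<^sup>+z. ennreal (g z) \<partial>\<nu>)"
    if "integrable \<mu> g" "integrable \<nu> g" for g :: "'a \<Rightarrow> real"
  proof -
    \<comment> \<open>Finiteness matters because \<open>enn2real\<close> sends \<infinity> to 0 and
      is not additive there.\<close>
    have "(\<integral>\<^sup>+z. ennreal (g z) \<partial>\<mu>) < \<infinity>" "(\<integral>\<^sup>+z. ennreal (g z) \<partial>\<nu>) < \<infinity>"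
      using that by (simp_all add: real_integrable_def less_top)
    moreover have "(\<lambda>z. ennreal (g z)) \<in> borel_measurable \<mu>" using that by auto
    ultimately show ?thesis
      using p by (simp add: nn_integral_mixture enn2real_plus enn2real_mult ennreal_mult_less_top)
  qed
  \<comment> \<open>\<open>ennreal\<close> truncates negative values to 0, so \<open>f\<close> and -
    f supply the positive and the negative part.\<close>
  from this[OF assms(1,2)] this[of "\<lambda>z. - f z"] show ?thesis
    using assms by (simp add: real_lebesgue_integral_def algebra_simps)
qed

end

lemma mixture_same:
  fixes c :: ennreal assumes "p \<in> {0..1}" shows "ennreal p * c + ennreal (1 - p) * c = c"
  using assms by (simp add: distrib_right[symmetric] ennreal_plus[symmetric] del: ennreal_plus)

lemma mixture_prob_with_marginal:
  fixes \<mu> \<nu> :: "('w \<times> 'x :: metric_space) measure"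
  assumes \<mu>: "\<mu> \<in> prob_with_marginal P" and \<nu>: "\<nu> \<in> prob_with_marginal P" and p: "p \<in> {0..1}"
  shows "mixture p \<mu> \<nu> \<in> prob_with_marginal P"
proof -
  have sets: "sets \<mu> = sets (P \<Otimes>\<^sub>M borel)" "sets \<nu> = sets (P \<Otimes>\<^sub>M borel)" "sets \<mu> = sets \<nu>"
    and dist: "distr \<mu> P fst = P" "distr \<nu> P fst = P"
    using \<mu> \<nu> by (auto simp: prob_with_marginal_def)
  have sp: "space \<nu> = space \<mu>" using sets_eq_imp_space_eq[OF sets(3)] by simp
  have prob: "emeasure \<mu> (space \<mu>) = 1" "emeasure \<nu> (space \<mu>) = 1"
    using \<mu> \<nu> prob_space.emeasure_space_1[of \<mu>] prob_space.emeasure_space_1[of \<nu>] sp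
    by (simp_all add: prob_with_marginal_def)
  have fst: "fst \<in> measurable K P" if "sets K = sets (P \<Otimes>\<^sub>M (borel :: 'x measure))" for K
    using that by (simp cong: measurable_cong_sets)
  have "prob_space (mixture p \<mu> \<nu>)"
    using prob mixture_same[OF p, of 1] by (intro prob_spaceI) (simp add: space_mixture[OF p sets(3)] emeasure_mixture[OF p sets(3)])
  moreover have smix: "sets (mixture p \<mu> \<nu>) = sets (P \<Otimes>\<^sub>M borel)"
    using sets by (simp add: sets_mixture[OF p sets(3)])
  moreover have "distr (mixture p \<mu> \<nu>) P fst = P"
  proof (rule measure_eqI)
    fix A assume "A \<in> sets (distr (mixture p \<mu> \<nu>) P fst)"
    then have A: "A \<in> sets P" by simp
    have "emeasure \<mu> (fst -` A \<inter> space \<mu>) = emeasure P A" "emeasure \<nu> (fst -` A \<inter> space \<mu>) = emeasure P A"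
      using emeasure_distr[OF fst[OF sets(1)] A] emeasure_distr[OF fst[OF sets(2)] A] dist sp by simp_all
    then show "emeasure (distr (mixture p \<mu> \<nu>) P fst) A = emeasure P A"
      using A measurable_sets[OF fst[OF sets(1)] A]
      by (simp add: emeasure_distr[OF fst[OF smix]] space_mixture[OF p sets(3)] emeasure_mixture[OF p sets(3)] mixture_same[OF p])
  qed simp
  ultimately show ?thesis by (simp add: prob_with_marginal_def)
qed

lemma mixture_measure_preserving:
  assumes p: "p \<in> {0..1}" and sets: "sets \<mu> = sets \<nu>"
    and "measure_preserving_map \<mu> \<phi>" "measure_preserving_map \<nu> \<phi>"
  shows "measure_preserving_map (mixture p \<mu> \<nu>) \<phi>"
proof -
  have sp: "space \<nu> = space \<mu>" using sets_eq_imp_space_eq[OF sets] by simp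
  have meas: "\<phi> \<in> measurable \<mu> \<mu>" and
    eq: "\<And>A. A \<in> sets \<mu> \<Longrightarrow> emeasure \<mu> (\<phi> -` A \<inter> space \<mu>) = emeasure \<mu> A"
      "\<And>A. A \<in> sets \<mu> \<Longrightarrow> emeasure \<nu> (\<phi> -` A \<inter> space \<mu>) = emeasure \<nu> A"
    using assms sp by (auto simp: measure_preserving_map_def)
  have "\<phi> \<in> measurable (mixture p \<mu> \<nu>) (mixture p \<mu> \<nu>)"
    using meas by (simp add: sets_mixture[OF p sets] cong: measurable_cong_sets)
  then show ?thesis
    using measurable_sets[OF meas] eq
    by (simp add: measure_preserving_map_def sets_mixture[OF p sets] space_mixture[OF p sets] emeasure_mixture[OF p sets])
qed

text \<open>For fixed f the map from \<mu> to \<Gamma> f - \<integral> f d\<mu> is weak-star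
  continuous. An infimum is below \<open>a\<close> exactly if some member is, so the strict sublevel
  set is a union of open sets.\<close>

lemma upper_semicontinuous_pressure_dual:
  assumes K: "K \<subseteq> prob_with_marginal P"
  shows "upper_semicontinuous (subtopology (weak_star_topology P) K) (pressure_dual P \<Gamma>)"
  unfolding upper_semicontinuous_def
proof
  fix a :: ereal
  define B where "B f = {\<mu> \<in> prob_with_marginal P. (\<integral>z. f z \<partial>\<mu>) \<in> {t. ereal (\<Gamma> f - t) < a}}" for f
  have sub: "\<Union>{{\<mu> \<in> prob_with_marginal P. (\<integral>z. f z \<partial>\<mu>) \<in> U} | f U. f \<in> L1C P \<and> open U} \<subseteq> prob_with_marginal P"
    by auto
  have open_B: "openin (weak_star_topology P) (B f)" if "f \<in> L1C P" for f
  proof -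
    have "open {t. ereal (\<Gamma> f - t) < a}"
      by (intro open_Collect_less continuous_intros)
    then show ?thesis
      unfolding weak_star_topology_def B_def using that by (intro topology_generated_by_Basis) blast
  qed
  have "{\<mu> \<in> topspace (subtopology (weak_star_topology P) K). pressure_dual P \<Gamma> \<mu> < a}
      = (\<Union>f\<in>L1C P. B f) \<inter> K"
  proof (intro equalityI subsetI)
    fix \<mu> assume "\<mu> \<in> {\<mu> \<in> topspace (subtopology (weak_star_topology P) K). pressure_dual P \<Gamma> \<mu> < a}"
    then have "\<mu> \<in> K" "pressure_dual P \<Gamma> \<mu> < a" by auto
    then show "\<mu> \<in> (\<Union>f\<in>L1C P. B f) \<inter> K"
      using K by (auto simp: pressure_dual_def INF_less_iff B_def)
  next
    fix \<mu> assume \<mu>: "\<mu> \<in> (\<Union>f\<in>L1C P. B f) \<inter> K"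
    then obtain f where f: "f \<in> L1C P" "\<mu> \<in> B f" by blast
    \<comment> \<open>The points of the topology are those covered by its generating sets, so
      membership is read off from the open set \<open>B f\<close>.\<close>
    then have "\<mu> \<in> topspace (weak_star_topology P)" using openin_subset[OF open_B] by blast
    moreover have "pressure_dual P \<Gamma> \<mu> < a"
      unfolding pressure_dual_def INF_less_iff using f by (auto simp: B_def)
    ultimately show "\<mu> \<in> {\<mu> \<in> topspace (subtopology (weak_star_topology P) K). pressure_dual P \<Gamma> \<mu> < a}"
      using \<mu> by simp
  qed
  moreover have "openin (weak_star_topology P) (\<Union>f\<in>L1C P. B f)"
    by (rule openin_Union) (use open_B in blast)
  ultimately show "openin (subtopology (weak_star_topology P) K)
      {\<mu> \<in> topspace (subtopology (weak_star_topology P) K). pressure_dual P \<Gamma> \<mu> < a}"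
    by (simp only: openin_subtopology_Int)
qed

context invariant_pressure
begin

lemma pressure_dual_le:
  assumes "\<mu> \<in> prob_with_marginal P"
  shows "pressure_dual P \<Gamma> \<mu> \<le> ereal (\<Gamma> (\<lambda>_. 0))"
  unfolding pressure_dual_def using INF_lower[OF zero_mem, of "\<lambda>f. ereal (\<Gamma> f - (\<integral>z. f z \<partial>\<mu>))"] by simp

text \<open>Translation invariance normalises any f to g = \<Gamma> f - f, which satisfies \<Gamma>
  (- g) = 0 and has integral \<Gamma> f - \<integral> f d\<mu>. Conversely, if \<Gamma> (- f) = 0,
  then - f contributes \<integral> f d\<mu> to the dual infimum.\<close>

lemma pressure_dual_eq:
  assumes \<mu>: "\<mu> \<in> prob_with_marginal P"
  shows "pressure_dual P \<Gamma> \<mu> = (INF f\<in>{f \<in> L1C P. \<Gamma> (\<lambda>z. - f z) = 0}. ereal (\<integral>z. f z \<partial>\<mu>))"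
proof (rule antisym)
  interpret \<mu>: prob_space \<mu> using \<mu> by (simp add: prob_with_marginal_def)
  show "pressure_dual P \<Gamma> \<mu> \<le> (INF f\<in>{f \<in> L1C P. \<Gamma> (\<lambda>z. - f z) = 0}. ereal (\<integral>z. f z \<partial>\<mu>))"
  proof (rule INF_greatest)
    fix f assume f: "f \<in> {f \<in> L1C P. \<Gamma> (\<lambda>z. - f z) = 0}"
    have "pressure_dual P \<Gamma> \<mu> \<le> ereal (\<Gamma> (\<lambda>z. - f z) - (\<integral>z. - f z \<partial>\<mu>))"
      unfolding pressure_dual_def using f by (intro INF_lower uminus_mem) simp
    then show "pressure_dual P \<Gamma> \<mu> \<le> ereal (\<integral>z. f z \<partial>\<mu>)" using f by simp
  qed
  show "(INF f\<in>{f \<in> L1C P. \<Gamma> (\<lambda>z. - f z) = 0}. ereal (\<integral>z. f z \<partial>\<mu>)) \<le> pressure_dual P \<Gamma> \<mu>"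
    unfolding pressure_dual_def
  proof (rule INF_greatest)
    fix f assume f: "f \<in> (L1C P :: ('w \<times> 'x \<Rightarrow> real) set)"
    define g where "g = (\<lambda>z. \<Gamma> f - f z)"
    have "g \<in> L1C P" unfolding g_def by (intro diff_mem const_mem f)
    moreover have "\<Gamma> (\<lambda>z. - g z) = 0"
      using pressure_add_const[OF f, of "- \<Gamma> f"] by (simp add: g_def)
    moreover have "(\<integral>z. g z \<partial>\<mu>) = \<Gamma> f - (\<integral>z. f z \<partial>\<mu>)"
      unfolding g_def using integrable_prob_with_marginal[OF compact_fibre \<mu> f] \<mu>.prob_space by simp
    ultimately show "(INF f\<in>{f \<in> L1C P. \<Gamma> (\<lambda>z. - f z) = 0}. ereal (\<integral>z. f z \<partial>\<mu>))
        \<le> ereal (\<Gamma> f - (\<integral>z. f z \<partial>\<mu>))"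
      by (intro INF_lower2[of g]) auto
  qed
qed

text \<open>For each f the expression under the infimum is affine along mixtures, and an infimum of
  affine functions is concave. The estimate is made in \<open>ereal\<close>, as the two dual values
  may be -\<infinity>.\<close>

lemma concave_pressure_dual:
  "concave_on_measures (invariant_measures P G act T) (pressure_dual P \<Gamma>)"
  unfolding concave_on_measures_def
proof (intro ballI conjI)
  fix \<mu> \<nu> and p :: real
  assume \<mu>: "\<mu> \<in> invariant_measures P G act T" and \<nu>: "\<nu> \<in> invariant_measures P G act T"
    and p: "p \<in> {0..1}"
  have marg: "\<mu> \<in> prob_with_marginal P" "\<nu> \<in> prob_with_marginal P"
    using \<mu> \<nu> by (auto simp: invariant_measures_def)
  have sets: "sets \<mu> = sets \<nu>" using marg by (simp add: prob_with_marginal_def)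
  have mix: "mixture p \<mu> \<nu> \<in> prob_with_marginal P" by (rule mixture_prob_with_marginal[OF marg p])
  show "mixture p \<mu> \<nu> \<in> invariant_measures P G act T"
    using \<mu> \<nu> mix mixture_measure_preserving[OF p sets] by (simp add: invariant_measures_def)
  show "ereal p * pressure_dual P \<Gamma> \<mu> + ereal (1 - p) * pressure_dual P \<Gamma> \<nu> \<le> pressure_dual P \<Gamma> (mixture p \<mu> \<nu>)"
    unfolding pressure_dual_def[of P \<Gamma> "mixture p \<mu> \<nu>"]
  proof (rule INF_greatest)
    fix f assume f: "f \<in> (L1C P :: ('w \<times> 'x \<Rightarrow> real) set)"
    have le: "pressure_dual P \<Gamma> \<kappa> \<le> ereal (\<Gamma> f - (\<integral>z. f z \<partial>\<kappa>))" for \<kappa>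
      unfolding pressure_dual_def using f by (rule INF_lower)
    have "ereal p * pressure_dual P \<Gamma> \<mu> + ereal (1 - p) * pressure_dual P \<Gamma> \<nu>
        \<le> ereal p * ereal (\<Gamma> f - (\<integral>z. f z \<partial>\<mu>)) + ereal (1 - p) * ereal (\<Gamma> f - (\<integral>z. f z \<partial>\<nu>))"
      using p le by (intro add_mono ereal_mult_left_mono) auto
    also have "\<dots> = ereal (\<Gamma> f - (p * (\<integral>z. f z \<partial>\<mu>) + (1 - p) * (\<integral>z. f z \<partial>\<nu>)))"
      by (simp add: algebra_simps)
    also have "p * (\<integral>z. f z \<partial>\<mu>) + (1 - p) * (\<integral>z. f z \<partial>\<nu>) = (\<integral>z. f z \<partial>mixture p \<mu> \<nu>)"
      using integrable_prob_with_marginal[OF compact_fibre] marg mix f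
      by (intro integral_mixture[OF p sets, symmetric]) auto
    finally show "ereal p * pressure_dual P \<Gamma> \<mu> + ereal (1 - p) * pressure_dual P \<Gamma> \<nu>
        \<le> ereal (\<Gamma> f - (\<integral>z. f z \<partial>mixture p \<mu> \<nu>))" .
  qed
qed

theorem variational_principle:
  "\<exists>\<mu>\<in>invariant_measures P G act T. pressure_dual P \<Gamma> \<mu> = ereal (\<Gamma> (\<lambda>_. 0))"
proof -
  obtain \<mu> where \<mu>: "\<mu> \<in> invariant_measures P G act T"
    and le: "\<And>f. f \<in> L1C P \<Longrightarrow> (\<integral>z. f z \<partial>\<mu>) \<le> \<Gamma> f - \<Gamma> (\<lambda>_. 0)"
    by (rule exists_equilibrium) blast
  \<comment> \<open>The bound on the integrals rearranges to \<Gamma> 0 \<le> \<Gamma> f -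
    \<integral> f d\<mu> for every f.\<close>
  have "ereal (\<Gamma> (\<lambda>_. 0)) \<le> pressure_dual P \<Gamma> \<mu>"
    unfolding pressure_dual_def using le by (intro INF_greatest) (simp add: le_diff_eq add.commute)
  then show ?thesis
    using \<mu> pressure_dual_le[of \<mu>] by (intro bexI[OF _ \<mu>] antisym) (auto simp: invariant_measures_def)
qed

end

theorem theorem1p1:
  fixes P :: "'w :: metric_space measure"
    and G :: "('g, 'b) monoid_scheme"
    and act :: "'g \<Rightarrow> 'w \<Rightarrow> 'w"
    and T :: "'g \<Rightarrow> 'w \<Rightarrow> 'x :: metric_space \<Rightarrow> 'x"
    and \<Gamma> :: "('w \<times> 'x \<Rightarrow> real) \<Rightarrow> real"
  assumes "(\<exists>k\<ge>1. G \<cong> Zplus k) \<or> (countable_amenable_group G \<and> infinite (carrier G))"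
    and "locally_compact_space (euclidean :: 'w topology)"
    and "separable_space (euclidean :: 'w topology)"
    and "sets P = sets borel"
    and "ergodic_system P G act"
    and "random_dynamical_system P G act T"
    and "random_pressure_function P G act T \<Gamma>"
  shows "(\<exists>\<mu>\<in>invariant_measures P G act T. pressure_dual P \<Gamma> \<mu> = ereal (\<Gamma> (\<lambda>_. 0))) \<and>
         (\<forall>\<mu>\<in>invariant_measures P G act T. pressure_dual P \<Gamma> \<mu> \<le> ereal (\<Gamma> (\<lambda>_. 0))) \<and>
         (\<forall>\<mu>\<in>invariant_measures P G act T.
            pressure_dual P \<Gamma> \<mu> =
              (INF f\<in>{f \<in> L1C P. \<Gamma> (\<lambda>z. - f z) = 0}. ereal (\<integral>z. f z \<partial>\<mu>))) \<and>
         concave_on_measures (invariant_measures P G act T) (pressure_dual P \<Gamma>) \<and>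
         upper_semicontinuous
           (subtopology (weak_star_topology P) (invariant_measures P G act T))
           (pressure_dual P \<Gamma>)"
proof -
  interpret rds: random_dynamical_system P G act T by fact
  \<comment> \<open>Both kinds of semigroup are reduced to common properties, transported along the
    isomorphism in the first case.\<close>
  have "left_cancellative G \<and> (\<exists>F. folner_sequence G F)"
    using assms(1)
  proof
    assume "\<exists>k\<ge>1. G \<cong> Zplus k"
    then obtain k \<phi> where \<phi>: "\<phi> \<in> iso G (Zplus k)" by (auto simp: is_iso_def)
    then show ?thesis
      using left_cancellative_iso[OF \<phi> left_cancellative_Zplus]
        folner_sequence_iso[OF rds.monoid_axioms \<phi> folner_sequence_Zplus] by blast
  next
    assume "countable_amenable_group G \<and> infinite (carrier G)"
    then show ?thesis by (auto simp: countable_amenable_group_def group.left_cancellative)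
  qed
  then obtain F where cancel: "left_cancellative G" and F: "folner_sequence G F" by blast
  interpret invariant_pressure P G act T \<Gamma> F
  proof unfold_locales
    show "space P = UNIV" using sets_eq_imp_space_eq[OF assms(4)] by simp
  qed (use assms(7) F cancel in \<open>auto simp: left_cancellative_def\<close>)
  have K: "invariant_measures P G act T \<subseteq> prob_with_marginal P"
    by (auto simp: invariant_measures_def)
  show ?thesis
    using variational_principle pressure_dual_le pressure_dual_eq concave_pressure_dual
      upper_semicontinuous_pressure_dual[OF K, of \<Gamma>] K by blast
qed

end
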